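(* Let $R>0$, let $B_R\subset\mathbb{R}^N$ be the open ball of radius $R$ centred at the origin, let $h\in C^{1}[0,\infty)$ be an increasing function with $h(t)>0$ for all $t>0$, and put $H(t)=\int_0^t h(k)\,dk$. Suppose that $(u,v)$ is a positive radial solution of $$\Delta u=|x|^{a}v^{p},\qquad \Delta v=|x|^{b}h(|\nabla u|)\qquad\text{in } B_R.$$ Then: (i) Both $u$ and $v$ are bounded if and only if $$\int_{1}^\infty\frac{ds}{\left(\int_0^s H(t)\,dt\right)^{p/(2p+1)}} = \infty .$$ (ii) $u$ is bounded and $\lim_{|x|\nearrow R}v(x)=\infty$ if and only if $$\int_{1}^\infty\frac{s\,ds}{\left(\int_0^s H(t)\,dt\right)^{p/(2p+1)}} <\infty .$$ (iii) $\lim_{|x|\nearrow R}u(x)=\lim_{|x|\nearrow R}v(x)=\infty$ if and only if $$\int_{1}^{\infty}\frac{ds}{\left(\int_{0}^{s}H(t)\,dt\right)^{p/(2p+1)}} <\infty\quad\text{and}\quad \int_{1}^{\infty}\frac{s\,ds}{\left(\int_{0}^{s}H(t)\,dt\right)^{p/(2p+1)}}=\infty .$$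
   Context: A positive radial solution is a pair $(u,v)$ of positive, radially symmetric functions on $B_R$ satisfying the system. The exponents $a,b,p$ are real numbers; the system is the special case $g(r,t)=r^{a}t^{p}$, $f(r,t)=r^{b}h(t)$ of the general system $\Delta u=g(|x|,v)$, $\Delta v=f(|x|,|\nabla u|)$, in which $f,g\in C^1([0,\infty)\times[0,\infty))$ are assumed throughout to be non-negative and increasing in both variables.
   Formalization: Restricting a solution to a smaller ball refutes (i) as stated. The equivalences are proved for solutions that do not extend to a larger ball; for all solutions, (i) "if" and the "only if" parts of (ii) and (iii) are proved. *)

theory Defs
  imports "HOL-Analysis.Analysis"
begin

text \<open>
  Real powers of non-negative reals. Unlike \<^const>\<open>powr\<close>, which has \<open>0 powr 0 = 0\<close>, the zeroth
  power is constantly \<open>1\<close>, so that \<open>r \<mapsto> r\<^sup>0\<close> is smooth on \<open>[0,\<infinity>)\<close>.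
\<close>
definition rpow :: "real \<Rightarrow> real \<Rightarrow> real" where
  "rpow x a = (if a = 0 then 1 else x powr a)"

text \<open>
  Class \<open>C\<^sup>1\<close> on a set. Derivatives are taken within \<open>S\<close>: on an open set they are the usual
  ones, on \<open>[0,\<infinity>)\<close> and on the closed quadrant they are one-sided at the boundary.
\<close>
definition C1_on :: "'a::real_normed_vector set \<Rightarrow> ('a \<Rightarrow> real) \<Rightarrow> bool" where
  "C1_on S f \<longleftrightarrow>
     (\<exists>f' :: 'a \<Rightarrow> 'a \<Rightarrow>\<^sub>L real.
        (\<forall>x\<in>S. (f has_derivative blinfun_apply (f' x)) (at x within S)) \<and> continuous_on S f')"

definition partial_deriv :: "'a::euclidean_space \<Rightarrow> ('a \<Rightarrow> real) \<Rightarrow> 'a \<Rightarrow> real" where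
  "partial_deriv i f x = frechet_derivative f (at x) i"

definition grad :: "('a::euclidean_space \<Rightarrow> real) \<Rightarrow> 'a \<Rightarrow> 'a" where
  "grad f x = (\<Sum>i\<in>Basis. partial_deriv i f x *\<^sub>R i)"

definition laplacian :: "('a::euclidean_space \<Rightarrow> real) \<Rightarrow> 'a \<Rightarrow> real" where
  "laplacian f x = (\<Sum>i\<in>Basis. partial_deriv i (partial_deriv i f) x)"

text \<open>Class \<open>C\<^sup>2\<close>; only meant for open \<open>S\<close>, since \<^const>\<open>partial_deriv\<close> is two-sided.\<close>
definition C2_on :: "'a::euclidean_space set \<Rightarrow> ('a \<Rightarrow> real) \<Rightarrow> bool" where
  "C2_on S f \<longleftrightarrow> C1_on S f \<and> (\<forall>i\<in>Basis. C1_on S (partial_deriv i f))"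

text \<open>
  The assumptions on the right-hand sides \<open>g(r,t)\<close>, \<open>f(r,t)\<close> of the system
  \<open>\<Delta>u = g(|x|,v)\<close>, \<open>\<Delta>v = f(|x|,|\<nabla>u|)\<close>. ``Increasing'' means non-decreasing; strict
  monotonicity is impossible for \<open>r\<^sup>a t\<^sup>p\<close> at \<open>t = 0\<close>.
\<close>
definition admissible :: "(real \<Rightarrow> real \<Rightarrow> real) \<Rightarrow> bool" where
  "admissible F \<longleftrightarrow>
     C1_on ({0..} \<times> {0..}) (\<lambda>(r, t). F r t) \<and>
     (\<forall>r\<ge>0. \<forall>t\<ge>0. F r t \<ge> 0) \<and>
     (\<forall>t\<ge>0. mono_on {0..} (\<lambda>r. F r t)) \<and>
     (\<forall>r\<ge>0. mono_on {0..} (\<lambda>t. F r t))"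

definition radial_on :: "real \<Rightarrow> ('a::euclidean_space \<Rightarrow> real) \<Rightarrow> bool" where
  "radial_on R u \<longleftrightarrow> (\<forall>x\<in>ball 0 R. \<forall>y\<in>ball 0 R. norm x = norm y \<longrightarrow> u x = u y)"

text \<open>Classical positive radial solutions; the values of \<open>u\<close>, \<open>v\<close> outside \<open>ball 0 R\<close> are irrelevant.\<close>
definition positive_radial_solution ::
  "(real \<Rightarrow> real \<Rightarrow> real) \<Rightarrow> (real \<Rightarrow> real \<Rightarrow> real) \<Rightarrow> real \<Rightarrow>
   ('a::euclidean_space \<Rightarrow> real) \<Rightarrow> ('a \<Rightarrow> real) \<Rightarrow> bool" where
  "positive_radial_solution g f R u v \<longleftrightarrow>
     C2_on (ball 0 R) u \<and> C2_on (ball 0 R) v \<and>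
     radial_on R u \<and> radial_on R v \<and>
     (\<forall>x\<in>ball 0 R. u x > 0 \<and> v x > 0) \<and>
     (\<forall>x\<in>ball 0 R. laplacian u x = g (norm x) (v x) \<and>
                    laplacian v x = f (norm x) (norm (grad u x)))"

text \<open>
  The ball of radius \<open>R\<close> is the maximal ball of existence of \<open>(u,v)\<close>. Restricting a solution to a
  smaller concentric ball always gives a bounded solution there, whatever the nonlinearities are;
  hence a criterion that reads the boundary behaviour of a given solution off the nonlinearities
  alone can only concern the maximal ball.
\<close>
definition non_continuable ::
  "(real \<Rightarrow> real \<Rightarrow> real) \<Rightarrow> (real \<Rightarrow> real \<Rightarrow> real) \<Rightarrow> real \<Rightarrow>
   ('a::euclidean_space \<Rightarrow> real) \<Rightarrow> ('a \<Rightarrow> real) \<Rightarrow> bool" where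
  "non_continuable g f R u v \<longleftrightarrow>
     \<not> (\<exists>R' u' v'. R' > R \<and> positive_radial_solution g f R' u' v' \<and>
                   (\<forall>x\<in>ball 0 R. u' x = u x \<and> v' x = v x))"

definition bounded_on_ball :: "real \<Rightarrow> ('a::euclidean_space \<Rightarrow> real) \<Rightarrow> bool" where
  "bounded_on_ball R u \<longleftrightarrow> bounded (u ` ball 0 R)"

text \<open>\<open>u(x) \<rightarrow> \<infinity>\<close> as \<open>|x| \<rightarrow> R\<close> from below, uniformly in the direction of \<open>x\<close>.\<close>
definition blows_up :: "real \<Rightarrow> ('a::euclidean_space \<Rightarrow> real) \<Rightarrow> bool" where
  "blows_up R u \<longleftrightarrow> filterlim u at_top (filtercomap norm (at_left R))"

definition primitive :: "(real \<Rightarrow> real) \<Rightarrow> real \<Rightarrow> real" where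
  "primitive h t = integral {0..t} h"

text \<open>
  The integral of \<open>s\<^sup>k (\<integral>\<^sub>0\<^sup>s H(t) dt)\<^bsup>-p/(2p+1)\<^esup>\<close> over \<open>[1,\<infinity>)\<close>, with value in \<open>[0,\<infinity>]\<close>, where
  \<open>H\<close> is the primitive of \<open>h\<close>.
\<close>
definition KO_integral :: "nat \<Rightarrow> (real \<Rightarrow> real) \<Rightarrow> real \<Rightarrow> ennreal" where
  "KO_integral k h p =
     (\<integral>\<^sup>+ s\<in>{1..}. ennreal (s ^ k / integral {0..s} (primitive h) powr (p / (2 * p + 1))) \<partial>lborel)"

end

theory Submission
  imports Defs
begin

text \<open>
  Write \<open>u(x) = U(|x|)\<close>, \<open>v(x) = V(|x|)\<close>, \<open>w = U'\<close>, \<open>Z = V'\<close>. Since \<open>V\<close> and \<open>w\<close> are monotone, the terms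
  \<open>(N-1) w/r\<close> and \<open>(N-1) Z/r\<close> only cost constants, and near the boundary the system reduces to
  \<open>w' \<asymp> V\<^sup>p\<close>, \<open>V'' \<asymp> h(w)\<close>. Comparing derivatives gives \<open>H(w) \<asymp> V\<^sup>p Z\<close> (the upper bound for
  \<open>V\<^sup>p Z\<close> needs \<open>Z\<^sup>2 \<le> C h(w) V\<close>, an energy estimate using that \<open>h(w)\<close> is monotone), and once more
  \<open>G(w) \<asymp> V\<^bsup>2p+1\<^esup>\<close> for \<open>G(s) = \<integral>\<^sub>0\<^sup>s H\<close>. So \<open>w' \<asymp> G(w)\<^sup>q\<close> with \<open>q = p/(2p+1)\<close>, and
  \<open>\<integral> s\<^sup>k G(s)\<^bsup>-q\<^esup> ds\<close> is comparable to \<open>\<integral> w\<^sup>k dr\<close>, that is, to \<open>R\<close> for \<open>k = 0\<close> and to \<open>U\<close> for \<open>k = 1\<close>,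
  as soon as \<open>w\<close> is unbounded. If \<open>V\<close> is bounded, then so are \<open>U\<close>, \<open>w\<close>, \<open>Z\<close>, and the Picard iteration
  continues the solution beyond \<open>R\<close>.
\<close>

section \<open>Growth estimates near the boundary\<close>

text \<open>No limit of a quotient is ever taken: \<open>F' \<le> K * E'\<close> with
  \<open>E\<close> nondecreasing and initially positive already gives \<open>F \<le> C * E\<close>.
  The partner of \<open>H(w)\<close> is \<open>V^p Z\<close>, because its derivative contains
  \<open>V^p Z'\<close>, which is comparable to \<open>h(w) w'\<close>. The other term,
  \<open>p V^(p-1) Z^2\<close>, is nonnegative: it is harmless for the upper bound of
  \<open>H(w)\<close> and is the obstacle for the lower one. One more factor \<open>w'\<close>
  produces \<open>V^(2p) Z\<close>, a multiple of \<open>(V^(2p+1))'\<close>; this is the origin of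
  the exponent \<open>p/(2p+1)\<close>.

  Everything happens on \<open>[R/2, R)\<close>, where the weights lie between positive constants
  and \<open>(N-1)/r\<close> is regular.

  Since a bounded \<open>V\<close> forces a bounded \<open>U\<close>, three cases are possible. If
  \<open>V\<close> is unbounded, the integral with \<open>k = 0\<close> is finite, and the one with
  \<open>k = 1\<close> is finite exactly when \<open>U\<close> is bounded. These facts hold on every
  ball and give the unconditional implications. The equivalences need the case of bounded
  \<open>V\<close> to be excluded, which is what non-continuability achieves; for such a solution
  both sides of the first equivalence are false.\<close>

lemma integral_0_continuous_on:
  fixes f :: "real \<Rightarrow> real"
  assumes "continuous_on {0..} f"
  shows "continuous_on {0..} (\<lambda>s. integral {0..s} f)"
proof -
  have *: "continuous_on {0..b} (\<lambda>s. integral {0..s} f)" for b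
    by (intro indefinite_integral_continuous_1 integrable_continuous_real
        continuous_on_subset[OF assms]) auto
  show ?thesis
    unfolding continuous_on_eq_continuous_within
  proof
    fix x :: real assume x: "x \<in> {0..}"
    have "continuous (at x within {0..x+1}) (\<lambda>s. integral {0..s} f)"
      using *[of "x+1"] x by (auto simp: continuous_on_eq_continuous_within)
    moreover have "at x within {0..x+1} = at x within {0..}"
      using x by (intro at_within_nhd[of _ "{x-1<..<x+1}"]) auto
    ultimately show "continuous (at x within {0..}) (\<lambda>s. integral {0..s} f)"
      by simp
  qed
qed

lemma integral_0_has_real_derivative:
  fixes f :: "real \<Rightarrow> real"
  assumes "continuous_on {0..} f" "s > 0"
  shows "((\<lambda>s. integral {0..s} f) has_real_derivative f s) (at s)"
proof -
  have "((\<lambda>s. integral {0..s} f) has_real_derivative f s) (at s within {0..s+1})"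
    using assms by (intro integral_has_real_derivative continuous_on_subset[OF assms(1)]) auto
  moreover have "at s within {0..s+1} = at s"
    using assms by (intro at_within_interior) auto
  ultimately show ?thesis by simp
qed

text \<open>Positivity is asked for on the open half-line only, since \<open>h 0\<close> may vanish;
  a positive derivative in the interior is enough for strict growth.\<close>

lemma integral_0_pos:
  fixes f :: "real \<Rightarrow> real"
  assumes "continuous_on {0..} f" "\<And>t. t > 0 \<Longrightarrow> f t > 0" "s > 0"
  shows "integral {0..s} f > 0"
proof -
  have "integral {0..0} f < integral {0..s} f"
  proof (rule DERIV_pos_imp_increasing_open[OF assms(3)])
    fix x assume "0 < x" "x < s"
    thus "\<exists>y. ((\<lambda>s. integral {0..s} f) has_real_derivative y) (at x) \<and> 0 < y"
      using integral_0_has_real_derivative[OF assms(1)] assms(2) by blast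
  qed (intro continuous_on_subset[OF integral_0_continuous_on[OF assms(1)]], simp)
  thus ?thesis by simp
qed

lemma nonneg_deriv_imp_le:
  fixes f f' :: "real \<Rightarrow> real"
  assumes "a \<le> b" "\<And>x. a \<le> x \<Longrightarrow> x \<le> b \<Longrightarrow> (f has_real_derivative f' x) (at x)"
    "\<And>x. a \<le> x \<Longrightarrow> x \<le> b \<Longrightarrow> 0 \<le> f' x"
  shows "f a \<le> f b"
proof (rule DERIV_nonneg_imp_nondecreasing[OF assms(1)])
  fix x assume "a \<le> x" "x \<le> b"
  thus "\<exists>y. (f has_real_derivative y) (at x) \<and> 0 \<le> y"
    using assms(2,3) by blast
qed

text \<open>\<open>\<bar>K\<bar> * E - F\<close> is nondecreasing, which bounds \<open>F\<close> by
  \<open>\<bar>K\<bar> * E\<close> up to an initial value. As \<open>E\<close> never falls below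
  \<open>E r0 > 0\<close>, that constant is itself dominated by a multiple of \<open>E\<close>. This
  takes the place of l'Hopital's rule.\<close>

lemma growth_comparison:
  fixes F E F' E' :: "real \<Rightarrow> real"
  assumes F: "\<And>r. r0 \<le> r \<Longrightarrow> r < R \<Longrightarrow> (F has_real_derivative F' r) (at r)"
    and E: "\<And>r. r0 \<le> r \<Longrightarrow> r < R \<Longrightarrow> (E has_real_derivative E' r) (at r)"
    and le: "\<And>r. r0 \<le> r \<Longrightarrow> r < R \<Longrightarrow> F' r \<le> K * E' r"
    and nonneg: "\<And>r. r0 \<le> r \<Longrightarrow> r < R \<Longrightarrow> 0 \<le> E' r"
    and pos: "0 < E r0"
  obtains C where "C > 0" "\<And>r. r0 \<le> r \<Longrightarrow> r < R \<Longrightarrow> F r \<le> C * E r"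
proof
  \<comment> \<open>\<open>\<bar>K\<bar>\<close> pays for the derivatives,
    \<open>\<bar>F r0\<bar> / E r0\<close> for the initial value, and \<open>1\<close> keeps
    \<open>C\<close> positive if both vanish.\<close>
  define C where "C = \<bar>K\<bar> + \<bar>F r0\<bar> / E r0 + 1"
  show "C > 0" unfolding C_def using pos by (simp add: add_nonneg_pos)
  fix r assume r: "r0 \<le> r" "r < R"
  have Er: "E r0 \<le> E r"
    using r by (intro nonneg_deriv_imp_le[OF r(1) E nonneg]) auto
  have d: "0 \<le> \<bar>K\<bar> * E' t - F' t" if "r0 \<le> t" "t \<le> r" for t
    using le[of t] mult_right_mono[OF abs_ge_self[of K] nonneg[of t]] that r by simp
  have "\<bar>K\<bar> * E r0 - F r0 \<le> \<bar>K\<bar> * E r - F r"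
    by (rule nonneg_deriv_imp_le[OF r(1) DERIV_diff[OF DERIV_cmult[OF E] F] d]) (use r in simp_all)
  moreover have "\<bar>K\<bar> * E r0 \<ge> 0" using pos by simp
  moreover have "\<bar>F r0\<bar> \<le> \<bar>F r0\<bar> / E r0 * E r"
    using mult_right_mono[OF Er abs_ge_zero[of "F r0"]] pos by (simp add: field_simps)
  moreover have "E r \<ge> 0" using Er pos by simp
  ultimately show "F r \<le> C * E r"
    unfolding C_def by (simp add: algebra_simps)
qed

text \<open>The dimension and the weights survive only in the four constants, so up to constants the
  system is autonomous. This is what allows functions of \<open>w\<close> alone to be compared with
  functions of \<open>V\<close> and \<open>Z\<close>.\<close>

locale boundary_system =
  fixes w V Z w' Z' h :: "real \<Rightarrow> real" and r0 R p c1 C1 c2 C2 :: real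
  assumes r0_less: "r0 < R" and p_nonneg: "0 \<le> p"
    and h_cont: "continuous_on {0..} h" and h_mono: "mono_on {0..} h"
    and h_pos: "\<And>t. t > 0 \<Longrightarrow> h t > 0"
    and w_deriv: "\<And>r. r0 \<le> r \<Longrightarrow> r < R \<Longrightarrow> (w has_real_derivative w' r) (at r)"
    and V_deriv: "\<And>r. r0 \<le> r \<Longrightarrow> r < R \<Longrightarrow> (V has_real_derivative Z r) (at r)"
    and Z_deriv: "\<And>r. r0 \<le> r \<Longrightarrow> r < R \<Longrightarrow> (Z has_real_derivative Z' r) (at r)"
    and w_pos: "\<And>r. r0 \<le> r \<Longrightarrow> r < R \<Longrightarrow> 0 < w r"
    and V_pos: "\<And>r. r0 \<le> r \<Longrightarrow> r < R \<Longrightarrow> 0 < V r"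
    and Z_pos: "\<And>r. r0 \<le> r \<Longrightarrow> r < R \<Longrightarrow> 0 < Z r"
    and consts_pos: "0 < c1" "0 < C1" "0 < c2" "0 < C2"
    and w'_ge: "\<And>r. r0 \<le> r \<Longrightarrow> r < R \<Longrightarrow> c1 * V r powr p \<le> w' r"
    and w'_le: "\<And>r. r0 \<le> r \<Longrightarrow> r < R \<Longrightarrow> w' r \<le> C1 * V r powr p"
    and Z'_ge: "\<And>r. r0 \<le> r \<Longrightarrow> r < R \<Longrightarrow> c2 * h (w r) \<le> Z' r"
    and Z'_le: "\<And>r. r0 \<le> r \<Longrightarrow> r < R \<Longrightarrow> Z' r \<le> C2 * h (w r)"
begin

abbreviation "H \<equiv> primitive h"
abbreviation "G \<equiv> (\<lambda>s. integral {0..s} H)"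
abbreviation "q \<equiv> p / (2 * p + 1)"

lemma H_eq: "H = (\<lambda>t. integral {0..t} h)"
  by (auto simp: primitive_def)

lemma H_cont: "continuous_on {0..} H"
  unfolding H_eq by (rule integral_0_continuous_on[OF h_cont])

lemma H_pos: "s > 0 \<Longrightarrow> H s > 0"
  unfolding H_eq by (rule integral_0_pos[OF h_cont h_pos])

lemma G_pos: "s > 0 \<Longrightarrow> G s > 0"
  by (rule integral_0_pos[OF H_cont H_pos])

lemma H_deriv: "s > 0 \<Longrightarrow> (H has_real_derivative h s) (at s)"
  unfolding H_eq by (rule integral_0_has_real_derivative[OF h_cont])

lemma G_deriv: "s > 0 \<Longrightarrow> (G has_real_derivative H s) (at s)"
  by (rule integral_0_has_real_derivative[OF H_cont])

lemma Hw_deriv: "r0 \<le> r \<Longrightarrow> r < R \<Longrightarrow> ((\<lambda>r. H (w r)) has_real_derivative h (w r) * w' r) (at r)"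
  using DERIV_chain2[OF H_deriv w_deriv] w_pos by blast

lemma Gw_deriv: "r0 \<le> r \<Longrightarrow> r < R \<Longrightarrow> ((\<lambda>r. G (w r)) has_real_derivative H (w r) * w' r) (at r)"
  using DERIV_chain2[OF G_deriv w_deriv] w_pos by blast

lemma w'_pos: "r0 \<le> r \<Longrightarrow> r < R \<Longrightarrow> 0 < w' r"
  using w'_ge[of r] V_pos[of r] consts_pos
  by (smt (verit) mult_pos_pos powr_gt_zero)

lemma w_mono: "r0 \<le> s \<Longrightarrow> s \<le> r \<Longrightarrow> r < R \<Longrightarrow> w s \<le> w r"
  by (rule nonneg_deriv_imp_le[OF _ w_deriv less_imp_le[OF w'_pos]]) auto

lemma V_mono: "r0 \<le> s \<Longrightarrow> s \<le> r \<Longrightarrow> r < R \<Longrightarrow> V s \<le> V r"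
  by (rule nonneg_deriv_imp_le[OF _ V_deriv less_imp_le[OF Z_pos]]) auto

lemma hw_mono: "r0 \<le> s \<Longrightarrow> s \<le> r \<Longrightarrow> r < R \<Longrightarrow> h (w s) \<le> h (w r)"
  using w_mono[of s r] w_pos[of s] by (intro mono_onD[OF h_mono]) auto

text \<open>The second term has the favourable sign when \<open>H (w r)\<close> is bounded from
  above, and has to be absorbed in the reverse bound.\<close>

lemma V_powr_Z_deriv:
  assumes "r0 \<le> r" "r < R"
  shows "((\<lambda>r. V r powr p * Z r) has_real_derivative
           V r powr p * Z' r + p * V r powr (p - 1) * (Z r)\<^sup>2) (at r)"
  using assms V_pos[OF assms]
  by (auto intro!: derivative_eq_intros V_deriv Z_deriv simp: power2_eq_square)

lemma V_powr_deriv: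
  assumes "r0 \<le> r" "r < R"
  shows "((\<lambda>r. V r powr (2 * p + 1)) has_real_derivative (2 * p + 1) * V r powr (2 * p) * Z r) (at r)"
  using assms V_pos[OF assms]
  by (auto intro!: derivative_eq_intros V_deriv)

lemma Z'_pos: "r0 \<le> r \<Longrightarrow> r < R \<Longrightarrow> 0 < Z' r"
  using Z'_ge[of r] h_pos[OF w_pos[of r]] consts_pos
  by (smt (verit) mult_pos_pos)

lemma V_powr_Z_deriv_nonneg:
  "r0 \<le> r \<Longrightarrow> r < R \<Longrightarrow> 0 \<le> V r powr p * Z' r + p * V r powr (p - 1) * (Z r)\<^sup>2"
  using Z'_pos[of r] p_nonneg by (intro add_nonneg_nonneg mult_nonneg_nonneg) auto

lemma V_powr_double: "r0 \<le> r \<Longrightarrow> r < R \<Longrightarrow> V r powr (2 * p) = V r powr p * V r powr p"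
  by (simp add: powr_add[symmetric])

text \<open>Two comparisons in a row. The derivative \<open>h (w r) * w' r\<close> of
  \<open>H (w r)\<close> is at most a multiple of \<open>V r powr p * Z' r\<close>, and the
  remaining term of \<open>(V powr p * Z)'\<close> only enlarges the right side. Multiplying the
  resulting bound for \<open>H (w r)\<close> by \<open>w' r \<le> C1 * V r powr p\<close> gives
  \<open>V r powr (2 * p) * Z r\<close>, which is integrated once more.\<close>

lemma G_w_le:
  obtains C where "C > 0" "\<And>r. r0 \<le> r \<Longrightarrow> r < R \<Longrightarrow> G (w r) \<le> C * V r powr (2 * p + 1)"
proof -
  have 1: "h (w r) * w' r \<le> C1 / c2 * (V r powr p * Z' r + p * V r powr (p - 1) * (Z r)\<^sup>2)"
    if r: "r0 \<le> r" "r < R" for r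
  proof -
    have "h (w r) * w' r \<le> (Z' r / c2) * (C1 * V r powr p)"
      using Z'_ge[OF r] w'_le[OF r] w'_pos[OF r] consts_pos Z'_pos[OF r]
      by (intro mult_mono) (auto simp: field_simps)
    also have "\<dots> = C1 / c2 * (V r powr p * Z' r + 0)" by simp
    also have "\<dots> \<le> C1 / c2 * (V r powr p * Z' r + p * V r powr (p - 1) * (Z r)\<^sup>2)"
      using consts_pos p_nonneg by (intro mult_left_mono add_left_mono) auto
    finally show ?thesis .
  qed
  have "0 < V r0 powr p * Z r0" using V_pos[of r0] Z_pos[of r0] r0_less by simp
  from growth_comparison[OF Hw_deriv V_powr_Z_deriv 1 V_powr_Z_deriv_nonneg this]
  obtain K where K: "K > 0" "\<And>r. r0 \<le> r \<Longrightarrow> r < R \<Longrightarrow> H (w r) \<le> K * (V r powr p * Z r)"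
    by blast
  have 2: "H (w r) * w' r \<le> K * C1 * ((2 * p + 1) * V r powr (2 * p) * Z r)"
    if r: "r0 \<le> r" "r < R" for r
  proof -
    have "H (w r) * w' r \<le> (K * (V r powr p * Z r)) * (C1 * V r powr p)"
      using K(2)[OF r] w'_le[OF r] w'_pos[OF r] H_pos[OF w_pos[OF r]] Z_pos[OF r] K(1)
      by (intro mult_mono) auto
    \<comment> \<open>The factor \<open>1\<close> is written out so that the next step can raise it
      to \<open>2 * p + 1\<close> and reach an exact derivative.\<close>
    also have "\<dots> = K * C1 * (1 * (V r powr (2 * p) * Z r))"
      by (simp add: V_powr_double[OF r])
    also have "\<dots> \<le> K * C1 * ((2 * p + 1) * (V r powr (2 * p) * Z r))"
      using K(1) consts_pos p_nonneg Z_pos[OF r] by (intro mult_left_mono mult_right_mono) auto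
    finally show ?thesis by (simp add: mult.assoc)
  qed
  have 3: "0 \<le> (2 * p + 1) * V r powr (2 * p) * Z r" if "r0 \<le> r" "r < R" for r
    using p_nonneg Z_pos[OF that] by simp
  have "0 < V r0 powr (2 * p + 1)" using V_pos[of r0] r0_less by simp
  from growth_comparison[OF Gw_deriv V_powr_deriv 2 3 this] that show thesis by blast
qed

text \<open>Energy with a frozen endpoint: for fixed \<open>r\<close>, the function
  \<open>2 * C2 * h (w r) * V t - (Z t)^2\<close> is nondecreasing in \<open>t\<close>, because
  \<open>Z' t \<le> C2 * h (w t) \<le> C2 * h (w r)\<close>. Freezing \<open>h (w r)\<close> avoids
  differentiating \<open>h\<close> along the orbit.\<close>

lemma Z_sq_le:
  obtains C where "C > 0" "\<And>r. r0 \<le> r \<Longrightarrow> r < R \<Longrightarrow> (Z r)\<^sup>2 \<le> C * (h (w r) * V r)"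
proof
  \<comment> \<open>The least value of \<open>h (w r) * V r\<close>; dividing by it turns the
    initial energy \<open>(Z r0)^2\<close> into a multiple of the right side.\<close>
  define e where "e = h (w r0) * V r0"
  have e: "e > 0" using h_pos[OF w_pos[of r0]] V_pos[of r0] r0_less by (simp add: e_def)
  define C where "C = 2 * C2 + (Z r0)\<^sup>2 / e"
  show "C > 0" unfolding C_def using e consts_pos by (simp add: add_pos_nonneg)
  fix r assume r: "r0 \<le> r" "r < R"
  have d: "0 \<le> 2 * C2 * h (w r) * Z t - 2 * Z t * Z' t" if t: "r0 \<le> t" "t \<le> r" for t
  proof -
    have "Z' t \<le> C2 * h (w r)"
      using Z'_le[of t] hw_mono[of t r] t r consts_pos by (smt (verit) mult_left_mono)
    from mult_left_mono[OF this, of "2 * Z t"] Z_pos[of t] t r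
    show ?thesis by (simp add: algebra_simps)
  qed
  have "2 * C2 * h (w r) * V r0 - (Z r0)\<^sup>2 \<le> 2 * C2 * h (w r) * V r - (Z r)\<^sup>2"
  proof (rule DERIV_nonneg_imp_nondecreasing[OF r(1)])
    fix t assume t: "r0 \<le> t" "t \<le> r"
    show "\<exists>y. ((\<lambda>a. 2 * C2 * h (w r) * V a - (Z a)\<^sup>2) has_real_derivative y) (at t) \<and> 0 \<le> y"
      using d[OF t] t r by (intro exI[of _ "2 * C2 * h (w r) * Z t - 2 * Z t * Z' t"])
        (auto intro!: derivative_eq_intros V_deriv Z_deriv)
  qed
  moreover have "0 \<le> 2 * C2 * h (w r) * V r0"
    using consts_pos h_pos[OF w_pos[OF r]] V_pos[of r0] r0_less by simp
  moreover have "e \<le> h (w r) * V r"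
    unfolding e_def using r hw_mono[of r0 r] V_mono[of r0 r] V_pos[of r0] h_pos[OF w_pos[OF r]]
    by (intro mult_mono) auto
  hence "(Z r0)\<^sup>2 \<le> (Z r0)\<^sup>2 / e * (h (w r) * V r)"
    using e mult_right_mono[of e "h (w r) * V r" "(Z r0)\<^sup>2"] by (simp add: field_simps)
  ultimately show "(Z r)\<^sup>2 \<le> C * (h (w r) * V r)"
    unfolding C_def by (simp add: algebra_simps)
qed

text \<open>The energy bound for \<open>(Z r)^2\<close> turns
  \<open>p * V r powr (p - 1) * (Z r)^2\<close> into at most a multiple of
  \<open>h (w r) * V r powr p\<close>. The whole derivative of \<open>V powr p * Z\<close> is then
  controlled by \<open>h (w r) * w' r\<close>, and the two comparisons run in the opposite
  direction.\<close>

lemma V_powr_le: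
  obtains C where "C > 0" "\<And>r. r0 \<le> r \<Longrightarrow> r < R \<Longrightarrow> V r powr (2 * p + 1) \<le> C * G (w r)"
proof -
  obtain K where K: "K > 0" "\<And>r. r0 \<le> r \<Longrightarrow> r < R \<Longrightarrow> (Z r)\<^sup>2 \<le> K * (h (w r) * V r)"
    using Z_sq_le by blast
  have 1: "V r powr p * Z' r + p * V r powr (p - 1) * (Z r)\<^sup>2 \<le> (C2 + p * K) / c1 * (h (w r) * w' r)"
    if r: "r0 \<le> r" "r < R" for r
  proof -
    have "V r powr p * Z' r \<le> V r powr p * (C2 * h (w r))"
      using Z'_le[OF r] by (intro mult_left_mono) simp_all
    moreover have "p * V r powr (p - 1) * (Z r)\<^sup>2 \<le> p * K * h (w r) * V r powr p"
    proof -
      have *: "V r powr (p - 1) * V r = V r powr p" using V_pos[OF r] by (simp add: powr_diff)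
      have "p * V r powr (p - 1) * (Z r)\<^sup>2 \<le> p * V r powr (p - 1) * (K * (h (w r) * V r))"
        using K(2)[OF r] p_nonneg by (intro mult_left_mono) auto
      also have "\<dots> = p * K * h (w r) * (V r powr (p - 1) * V r)" by simp
      finally show ?thesis by (simp only: *)
    qed
    ultimately have "V r powr p * Z' r + p * V r powr (p - 1) * (Z r)\<^sup>2
        \<le> (C2 + p * K) * h (w r) * V r powr p"
      by (simp add: algebra_simps)
    also have "\<dots> \<le> (C2 + p * K) * h (w r) * (w' r / c1)"
      using w'_ge[OF r] consts_pos K(1) p_nonneg h_pos[OF w_pos[OF r]]
      by (intro mult_left_mono) (auto simp: field_simps)
    finally show ?thesis by simp
  qed
  have 2: "0 \<le> h (w r) * w' r" if "r0 \<le> r" "r < R" for r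
    using h_pos[OF w_pos[OF that]] w'_pos[OF that] by simp
  have "0 < H (w r0)" using H_pos w_pos r0_less by simp
  from growth_comparison[OF V_powr_Z_deriv Hw_deriv 1 2 this]
  obtain L where L: "L > 0" "\<And>r. r0 \<le> r \<Longrightarrow> r < R \<Longrightarrow> V r powr p * Z r \<le> L * H (w r)"
    by blast
  have 3: "(2 * p + 1) * V r powr (2 * p) * Z r \<le> (2 * p + 1) * L / c1 * (H (w r) * w' r)"
    if r: "r0 \<le> r" "r < R" for r
  proof -
    have "(V r powr p * Z r) * V r powr p \<le> (L * H (w r)) * (w' r / c1)"
    proof (rule mult_mono[OF L(2)[OF r]])
      show "V r powr p \<le> w' r / c1" using w'_ge[OF r] consts_pos by (simp add: field_simps)
    qed (use H_pos[OF w_pos[OF r]] L(1) in auto)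
    from mult_left_mono[OF this, of "2 * p + 1"] p_nonneg
    show ?thesis unfolding V_powr_double[OF r] by (simp add: mult_ac)
  qed
  have 4: "0 \<le> H (w r) * w' r" if "r0 \<le> r" "r < R" for r
    using H_pos[OF w_pos[OF that]] w'_pos[OF that] by simp
  have "0 < G (w r0)" using G_pos w_pos r0_less by simp
  from growth_comparison[OF V_powr_deriv Gw_deriv 3 4 this] that show thesis by blast
qed

lemma V_powr_q: "r0 \<le> r \<Longrightarrow> r < R \<Longrightarrow> V r powr p = (V r powr (2 * p + 1)) powr q"
  using p_nonneg by (simp add: powr_powr)

lemma q_nonneg: "q \<ge> 0" using p_nonneg by simp

text \<open>Eliminates \<open>V\<close>: since \<open>V r powr p\<close> is the \<open>q\<close>-th
  power of \<open>V r powr (2 * p + 1)\<close>, the bound for \<open>G (w r)\<close> reduces the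
  system to one differential inequality for \<open>w\<close>.\<close>

lemma w'_lower:
  obtains c where "c > 0" "\<And>r. r0 \<le> r \<Longrightarrow> r < R \<Longrightarrow> c * G (w r) powr q \<le> w' r"
proof -
  obtain K where K: "K > 0" "\<And>r. r0 \<le> r \<Longrightarrow> r < R \<Longrightarrow> G (w r) \<le> K * V r powr (2 * p + 1)"
    using G_w_le by blast
  show thesis
  proof (rule that[of "c1 / K powr q"])
    show "c1 / K powr q > 0" using consts_pos K(1) by auto
    fix r assume r: "r0 \<le> r" "r < R"
    have "G (w r) powr q \<le> (K * V r powr (2 * p + 1)) powr q"
      using K(2)[OF r] G_pos[OF w_pos[OF r]] q_nonneg by (intro powr_mono2) auto
    also have "\<dots> = K powr q * V r powr p"
      using K(1) by (simp add: powr_mult V_powr_q[OF r])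
    finally have "c1 / K powr q * G (w r) powr q \<le> c1 / K powr q * (K powr q * V r powr p)"
      using consts_pos by (intro mult_left_mono) auto
    also have "\<dots> = c1 * V r powr p" using K(1) by simp
    finally show "c1 / K powr q * G (w r) powr q \<le> w' r" using w'_ge[OF r] by simp
  qed
qed

lemma w'_upper:
  obtains C where "C > 0" "\<And>r. r0 \<le> r \<Longrightarrow> r < R \<Longrightarrow> w' r \<le> C * G (w r) powr q"
proof -
  obtain L where L: "L > 0" "\<And>r. r0 \<le> r \<Longrightarrow> r < R \<Longrightarrow> V r powr (2 * p + 1) \<le> L * G (w r)"
    using V_powr_le by blast
  show thesis
  proof (rule that[of "C1 * L powr q"])
    show "C1 * L powr q > 0" using consts_pos L(1) by auto
    fix r assume r: "r0 \<le> r" "r < R"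
    have "V r powr p \<le> (L * G (w r)) powr q"
      unfolding V_powr_q[OF r] using L(2)[OF r] q_nonneg by (intro powr_mono2) auto
    also have "\<dots> = L powr q * G (w r) powr q"
      using L(1) G_pos[OF w_pos[OF r]] by (simp add: powr_mult)
    finally have "C1 * V r powr p \<le> C1 * (L powr q * G (w r) powr q)"
      using consts_pos by (intro mult_left_mono) auto
    thus "w' r \<le> C1 * L powr q * G (w r) powr q" using w'_le[OF r] by simp
  qed
qed

section \<open>Convergence of the integrals, tested along the orbit of \<open>w\<close>\<close>

definition KO_integrand :: "nat \<Rightarrow> real \<Rightarrow> real" where
  "KO_integrand k s = s ^ k / G s powr q"

text \<open>The cut-off at \<open>1\<close> removes the possible singularity of the integrand at
  \<open>0\<close>, where \<open>G\<close> vanishes. Integrating from \<open>0\<close> and not from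
  \<open>1\<close> makes \<open>1\<close> an interior point, so that the derivative there is
  two-sided.\<close>

definition KO_prim :: "nat \<Rightarrow> real \<Rightarrow> real" where
  "KO_prim k s = integral {0..s} (\<lambda>x. KO_integrand k (max 1 x))"

lemma G_cont: "continuous_on {0..} G"
  by (rule integral_0_continuous_on[OF H_cont])

lemma KO_integrand_cont: "continuous_on UNIV (\<lambda>x. KO_integrand k (max 1 x))"
proof -
  have "continuous_on {1..} (KO_integrand k)"
    unfolding KO_integrand_def
  proof (intro continuous_intros continuous_on_subset[OF G_cont] ballI)
    fix x :: real assume "x \<in> {1..}"
    hence "G x > 0" by (intro G_pos) auto
    thus "G x \<noteq> 0" "G x powr q \<noteq> 0" by auto
  qed auto
  moreover have "continuous_on UNIV (\<lambda>x::real. max 1 x)" by (intro continuous_intros)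
  ultimately show ?thesis by (rule continuous_on_compose2) auto
qed

lemma KO_integrand_nonneg: "s \<ge> 1 \<Longrightarrow> KO_integrand k s \<ge> 0"
  by (simp add: KO_integrand_def)

lemma KO_prim_deriv: "s \<ge> 1 \<Longrightarrow> (KO_prim k has_real_derivative KO_integrand k s) (at s)"
  unfolding KO_prim_def
  using integral_0_has_real_derivative[OF continuous_on_subset[OF KO_integrand_cont[of k]], of s]
  by (simp add: max_absorb2)

lemma KO_prim_mono: "1 \<le> s \<Longrightarrow> s \<le> t \<Longrightarrow> KO_prim k s \<le> KO_prim k t"
  by (rule nonneg_deriv_imp_le[OF _ KO_prim_deriv KO_integrand_nonneg]) auto

lemma KO_integral_eq:
  "KO_integral k h p = (\<integral>\<^sup>+ s. ennreal (KO_integrand k (max 1 s)) * indicator {1..} s \<partial>lborel)"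
  unfolding KO_integral_def KO_integrand_def
  by (intro nn_integral_cong) (auto simp: indicator_def max_absorb2)

lemma KO_integrand_borel: "(\<lambda>s. KO_integrand k (max 1 s)) \<in> borel_measurable borel"
  by (rule borel_measurable_continuous_onI[OF KO_integrand_cont])

text \<open>The integrand is nonnegative, so its primitive is monotone and converges exactly when it
  is bounded. This trades an integral with values in \<open>ennreal\<close> for a real function that
  can be composed with \<open>w\<close> and differentiated.\<close>

lemma KO_integral_finite_iff: "KO_integral k h p < \<infinity> \<longleftrightarrow> (\<exists>B. \<forall>s\<ge>1. KO_prim k s \<le> B)"
proof
  assume fin: "KO_integral k h p < \<infinity>"
  have "KO_prim k s \<le> KO_prim k 1 + enn2real (KO_integral k h p)" if s: "s \<ge> 1" for s
  proof -
    have "ennreal (KO_prim k s - KO_prim k 1) =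
        (\<integral>\<^sup>+ x. ennreal (KO_integrand k (max 1 x)) * indicator {1..s} x \<partial>lborel)"
      using s KO_prim_deriv[of _ k] KO_integrand_nonneg[of _ k]
      by (intro nn_integral_FTC_Icc[symmetric] KO_integrand_borel) (auto simp: max_absorb2 intro: DERIV_subset)
    also have "\<dots> \<le> KO_integral k h p"
      unfolding KO_integral_eq by (intro nn_integral_mono) (auto simp: indicator_def)
    also have "\<dots> = ennreal (enn2real (KO_integral k h p))" using fin by simp
    finally show ?thesis by (simp add: ennreal_le_iff)
  qed
  thus "\<exists>B. \<forall>s\<ge>1. KO_prim k s \<le> B" by blast
next
  assume "\<exists>B. \<forall>s\<ge>1. KO_prim k s \<le> B"
  then obtain B where B: "\<And>s. s \<ge> 1 \<Longrightarrow> KO_prim k s \<le> B" by blast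
  define T where "T = (SUP s\<in>{1..}. KO_prim k s)"
  have bdd: "bdd_above (KO_prim k ` {1..})" using B by (auto simp: bdd_above_def)
  have "(KO_prim k \<longlongrightarrow> T) at_top"
  proof (rule increasing_tendsto)
    show "\<forall>\<^sub>F s in at_top. KO_prim k s \<le> T"
      using eventually_ge_at_top[of "1::real"] unfolding T_def
      by eventually_elim (rule cSUP_upper[OF _ bdd], simp)
    fix x assume "x < T"
    then obtain s where s: "s \<ge> 1" "x < KO_prim k s"
      unfolding T_def using less_cSUP_iff[OF _ bdd] by auto
    show "\<forall>\<^sub>F s in at_top. x < KO_prim k s"
      using eventually_ge_at_top[of s] by eventually_elim (use s KO_prim_mono[of s _ k] in force)
  qed
  from nn_integral_FTC_atLeast[OF KO_integrand_borel _ _ this, of 1]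
  have "KO_integral k h p = ennreal (T - KO_prim k 1)"
    unfolding KO_integral_eq using KO_prim_deriv KO_integrand_nonneg by (simp add: max_absorb2)
  thus "KO_integral k h p < \<infinity>" by simp
qed

lemma KO_prim_w_deriv:
  assumes "r0 \<le> r" "r < R" "w r \<ge> 1"
  shows "((\<lambda>r. KO_prim k (w r)) has_real_derivative KO_integrand k (w r) * w' r) (at r)"
  by (rule DERIV_chain2[OF KO_prim_deriv[OF assms(3)] w_deriv[OF assms(1,2)]])

lemma G_w_powr_pos: "r0 \<le> r \<Longrightarrow> r < R \<Longrightarrow> 0 < G (w r) powr q"
  using G_pos[OF w_pos[of r]] by simp

text \<open>Along the orbit the primitive has derivative
  \<open>w r ^ k / G (w r) powr q * w' r \<le> C * w r ^ k\<close>, that is, at most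
  \<open>C\<close> times the derivative of \<open>Y\<close>. The choices of interest are
  \<open>Y r = r\<close> for \<open>k = 0\<close> and \<open>Y = U\<close> for
  \<open>k = 1\<close>.\<close>

lemma KO_integral_finite:
  assumes Y: "\<And>r. r0 \<le> r \<Longrightarrow> r < R \<Longrightarrow> (Y has_real_derivative w r ^ k) (at r)"
    and B: "\<And>r. r0 \<le> r \<Longrightarrow> r < R \<Longrightarrow> Y r \<le> B"
    and w: "\<And>s. \<exists>r. r0 \<le> r \<and> r < R \<and> s \<le> w r"
  shows "KO_integral k h p < \<infinity>"
proof -
  obtain C where C: "C > 0" "\<And>r. r0 \<le> r \<Longrightarrow> r < R \<Longrightarrow> w' r \<le> C * G (w r) powr q"
    using w'_upper by blast
  \<comment> \<open>From \<open>r1\<close> on \<open>w\<close> stays in the range where the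
    primitive has the untruncated integrand as derivative.\<close>
  obtain r1 where r1: "r0 \<le> r1" "r1 < R" "1 \<le> w r1" using w[of 1] by blast
  have w1: "w r \<ge> 1" if "r1 \<le> r" "r < R" for r
    using w_mono[of r1 r] r1 that by simp
  have d: "0 \<le> C * w r ^ k - KO_integrand k (w r) * w' r" if r: "r1 \<le> r" "r < R" for r
  proof -
    have "KO_integrand k (w r) * w' r \<le> KO_integrand k (w r) * (C * G (w r) powr q)"
      using C(2)[of r] KO_integrand_nonneg[OF w1[OF r]] r r1 by (intro mult_left_mono) auto
    also have "\<dots> = C * w r ^ k"
      using G_w_powr_pos[of r] r r1 by (simp add: KO_integrand_def)
    finally show ?thesis by simp
  qed
  have le: "KO_prim k (w r) \<le> KO_prim k (w r1) + C * B - C * Y r1" if r: "r1 \<le> r" "r < R" for r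
  proof -
    have "C * Y r1 - KO_prim k (w r1) \<le> C * Y r - KO_prim k (w r)"
      by (rule nonneg_deriv_imp_le[OF r(1) DERIV_diff[OF DERIV_cmult[OF Y] KO_prim_w_deriv] d])
         (use r r1 w1 in simp_all)
    moreover have "C * Y r \<le> C * B" using B[of r] r r1 C(1) by simp
    ultimately show ?thesis by simp
  qed
  \<comment> \<open>Unboundedness of \<open>w\<close> enters here: every \<open>s\<close> is
    exceeded by some value of \<open>w\<close>, so a bound along the orbit bounds the whole
    primitive.\<close>
  have "KO_prim k s \<le> KO_prim k (w r1) + C * B - C * Y r1" if s: "s \<ge> 1" for s
  proof -
    obtain r where r: "r0 \<le> r" "r < R" "s \<le> w r" using w by blast
    define r' where "r' = max r r1"
    have r': "r1 \<le> r'" "r' < R" "r \<le> r'" unfolding r'_def using r r1 by auto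
    have "s \<le> w r'" using w_mono[OF r(1) r'(3,2)] r(3) by simp
    from KO_prim_mono[OF s this, of k] le[OF r'(1,2)] show ?thesis by simp
  qed
  thus ?thesis unfolding KO_integral_finite_iff by blast
qed

text \<open>The lower bound for \<open>w'\<close> reverses the comparison: \<open>c * Y\<close>
  grows no faster than the primitive along the orbit, so a convergent integral would bound
  \<open>Y\<close>.\<close>

lemma KO_integral_infinite:
  assumes Y: "\<And>r. r0 \<le> r \<Longrightarrow> r < R \<Longrightarrow> (Y has_real_derivative w r ^ k) (at r)"
    and B: "\<And>s. \<exists>r. r0 \<le> r \<and> r < R \<and> s \<le> Y r"
    and w: "\<And>s. \<exists>r. r0 \<le> r \<and> r < R \<and> s \<le> w r"
  shows "KO_integral k h p = \<infinity>"
proof (rule ccontr)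
  assume "KO_integral k h p \<noteq> \<infinity>"
  hence "KO_integral k h p < \<infinity>" by (simp add: less_top)
  then obtain B where B': "\<And>s. s \<ge> 1 \<Longrightarrow> KO_prim k s \<le> B"
    unfolding KO_integral_finite_iff by blast
  obtain c where c: "c > 0" "\<And>r. r0 \<le> r \<Longrightarrow> r < R \<Longrightarrow> c * G (w r) powr q \<le> w' r"
    using w'_lower by blast
  obtain r1 where r1: "r0 \<le> r1" "r1 < R" "1 \<le> w r1" using w[of 1] by blast
  have w1: "w r \<ge> 1" if "r1 \<le> r" "r < R" for r
    using w_mono[of r1 r] r1 that by simp
  have Y_mono: "Y r \<le> Y s" if "r0 \<le> r" "r \<le> s" "s < R" for r s
    by (rule nonneg_deriv_imp_le[OF that(2) Y]) (use that w_pos in \<open>auto simp: less_imp_le\<close>)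
  have d: "0 \<le> KO_integrand k (w r) * w' r - c * w r ^ k" if r: "r1 \<le> r" "r < R" for r
  proof -
    have "c * w r ^ k = KO_integrand k (w r) * (c * G (w r) powr q)"
      using G_w_powr_pos[of r] r r1 by (simp add: KO_integrand_def)
    also have "\<dots> \<le> KO_integrand k (w r) * w' r"
      using c(2)[of r] KO_integrand_nonneg[OF w1[OF r]] r r1 by (intro mult_left_mono) auto
    finally show ?thesis by simp
  qed
  have le: "c * Y r \<le> B - KO_prim k (w r1) + c * Y r1" if r: "r1 \<le> r" "r < R" for r
  proof -
    have "KO_prim k (w r1) - c * Y r1 \<le> KO_prim k (w r) - c * Y r"
      by (rule nonneg_deriv_imp_le[OF r(1) DERIV_diff[OF KO_prim_w_deriv DERIV_cmult[OF Y]] d])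
         (use r r1 w1 in simp_all)
    thus ?thesis using B'[OF w1[OF r]] by simp
  qed
  \<comment> \<open>One more than the bound that the preceding estimate imposes on \<open>Y\<close>
    beyond \<open>r1\<close>.\<close>
  define M where "M = (B - KO_prim k (w r1) + c * Y r1) / c + 1"
  obtain r where r: "r0 \<le> r" "r < R" "M \<le> Y r" using B by blast
  define r' where "r' = max r r1"
  have r': "r1 \<le> r'" "r' < R" "r \<le> r'" unfolding r'_def using r r1 by auto
  have "M \<le> Y r'" using Y_mono[OF r(1) r'(3,2)] r(3) by simp
  moreover have "Y r' \<le> M - 1" using le[OF r'(1,2)] c(1) by (simp add: M_def field_simps)
  ultimately show False by simp
qed

section \<open>Transfer of bounds between \<open>V\<close>, \<open>w\<close> and
  \<open>Z\<close>\<close>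

lemma le_of_deriv_le:
  assumes f: "\<And>r. r0 \<le> r \<Longrightarrow> r < R \<Longrightarrow> (f has_real_derivative f' r) (at r)"
    and B: "\<And>r. r0 \<le> r \<Longrightarrow> r < R \<Longrightarrow> f' r \<le> B" and r: "r0 \<le> r" "r < R"
  shows "f r \<le> f r0 + \<bar>B\<bar> * (R - r0)"
proof -
  have "\<bar>B\<bar> * r0 - f r0 \<le> \<bar>B\<bar> * r - f r"
    by (rule nonneg_deriv_imp_le[OF r(1) DERIV_diff[OF DERIV_cmult_Id f]]) (use r B abs_ge_self[of B] in \<open>force+\<close>)
  moreover have "\<bar>B\<bar> * r \<le> \<bar>B\<bar> * R" using r by (intro mult_left_mono) auto
  ultimately show ?thesis by (simp add: algebra_simps)
qed

text \<open>A bound on \<open>w\<close> bounds \<open>Z'\<close> through the monotone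
  \<open>h\<close>; integrating twice over an interval of finite length bounds \<open>Z\<close> and
  then \<open>V\<close>.\<close>

lemma V_bounded_if_w_bounded:
  assumes "\<And>r. r0 \<le> r \<Longrightarrow> r < R \<Longrightarrow> w r \<le> B"
  obtains B' where "\<And>r. r0 \<le> r \<Longrightarrow> r < R \<Longrightarrow> V r \<le> B'"
proof -
  have "Z' r \<le> C2 * h B" if r: "r0 \<le> r" "r < R" for r
  proof -
    have "h (w r) \<le> h B"
      using assms[OF r] w_pos[OF r] by (intro mono_onD[OF h_mono]) auto
    thus ?thesis using Z'_le[OF r] consts_pos by (smt (verit) mult_left_mono)
  qed
  from le_of_deriv_le[OF V_deriv le_of_deriv_le[OF Z_deriv this]] that show thesis by blast
qed

lemma w_bounded_if_V_bounded:
  assumes "\<And>r. r0 \<le> r \<Longrightarrow> r < R \<Longrightarrow> V r \<le> B"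
  obtains B' where "\<And>r. r0 \<le> r \<Longrightarrow> r < R \<Longrightarrow> w r \<le> B'"
proof -
  have "w' r \<le> C1 * B powr p" if r: "r0 \<le> r" "r < R" for r
  proof -
    have "V r powr p \<le> B powr p" 
      using assms[OF r] V_pos[OF r] p_nonneg by (intro powr_mono2) auto
    thus ?thesis using w'_le[OF r] consts_pos by (smt (verit) mult_left_mono)
  qed
  from le_of_deriv_le[OF w_deriv this] that show thesis by blast
qed

lemma Z_bounded_if_w_bounded:
  assumes "\<And>r. r0 \<le> r \<Longrightarrow> r < R \<Longrightarrow> w r \<le> B"
  obtains B' where "\<And>r. r0 \<le> r \<Longrightarrow> r < R \<Longrightarrow> Z r \<le> B'"
proof -
  have "Z' r \<le> C2 * h B" if r: "r0 \<le> r" "r < R" for r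
  proof -
    have "h (w r) \<le> h B"
      using assms[OF r] w_pos[OF r] by (intro mono_onD[OF h_mono]) auto
    thus ?thesis using Z'_le[OF r] consts_pos by (smt (verit) mult_left_mono)
  qed
  from le_of_deriv_le[OF Z_deriv this] that show thesis by blast
qed

end

section \<open>Radial functions\<close>

lemma partial_deriv_cong:
  assumes "open T" "x \<in> T" "\<And>y. y \<in> T \<Longrightarrow> f y = g y"
  shows "partial_deriv i f x = partial_deriv i g x"
proof -
  \<comment> \<open>\<open>frechet_derivative\<close> is a choice operator, so it suffices that both
    functions have the same set of derivatives at \<open>x\<close>; this also covers points where
    that set is empty.\<close>
  have "(f has_derivative D) (at x) \<longleftrightarrow> (g has_derivative D) (at x)" for D
    using has_derivative_transform_within_open[of f D x UNIV T g]
      has_derivative_transform_within_open[of g D x UNIV T f] assms by auto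
  thus ?thesis by (simp add: partial_deriv_def frechet_derivative_def)
qed

lemma grad_cong:
  assumes "open T" "x \<in> T" "\<And>y. y \<in> T \<Longrightarrow> f y = g y"
  shows "grad f x = grad g x"
  unfolding grad_def using partial_deriv_cong[OF assms] by simp

lemma laplacian_cong:
  assumes "open T" "x \<in> T" "\<And>y. y \<in> T \<Longrightarrow> f y = g y"
  shows "laplacian f x = laplacian g x"
  unfolding laplacian_def
  by (intro sum.cong refl partial_deriv_cong[OF assms(1,2)] partial_deriv_cong[OF assms(1)] assms(3))

lemma partial_deriv_eqI: "(f has_derivative D) (at x) \<Longrightarrow> partial_deriv i f x = D i"
  unfolding partial_deriv_def using frechet_derivative_at by metis

lemma grad_has_derivative:
  assumes "(f has_derivative D) (at x)"
  shows "(f has_derivative (\<lambda>h. grad f x \<bullet> h)) (at x)"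
proof -
  interpret D: bounded_linear D using assms by (rule has_derivative_bounded_linear)
  have "D h = grad f x \<bullet> h" for h
  proof -
    have "D h = D (\<Sum>i\<in>Basis. (h \<bullet> i) *\<^sub>R i)" by (simp add: euclidean_representation)
    also have "\<dots> = (\<Sum>i\<in>Basis. (h \<bullet> i) * D i)" by (simp add: D.sum D.scaleR)
    also have "\<dots> = grad f x \<bullet> h"
      by (simp add: grad_def inner_sum_left partial_deriv_eqI[OF assms] inner_commute[of h] mult.commute)
    finally show ?thesis .
  qed
  thus ?thesis using assms by (metis (no_types, lifting) ext)
qed

lemma grad_eqI:
  assumes "(f has_derivative (\<lambda>h. d \<bullet> h)) (at x)"
  shows "grad f x = d"
  unfolding grad_def partial_deriv_eqI[OF assms] by (simp add: euclidean_representation)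

text \<open>On an open set the derivative is unique and is represented by \<open>grad f\<close>, so
  the existentially quantified derivative can be replaced by it, and continuity in operator norm
  becomes continuity of a vector field.\<close>

lemma C1_on_open_iff:
  fixes S :: "'a::euclidean_space set"
  assumes "open S"
  shows "C1_on S f \<longleftrightarrow>
    (\<forall>x\<in>S. (f has_derivative (\<lambda>h. grad f x \<bullet> h)) (at x)) \<and> continuous_on S (grad f)"
proof
  assume "C1_on S f"
  then obtain f' where f': "\<And>x. x \<in> S \<Longrightarrow> (f has_derivative blinfun_apply (f' x)) (at x)"
    "continuous_on S f'"
    unfolding C1_on_def using at_within_open[OF _ assms] by fastforce
  have "continuous_on S (grad f) \<longleftrightarrow> continuous_on S (\<lambda>x. \<Sum>i\<in>Basis. blinfun_apply (f' x) i *\<^sub>R i)"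
    using partial_deriv_eqI[OF f'(1)] by (intro continuous_on_cong) (simp_all add: grad_def)
  moreover have "continuous_on S (\<lambda>x. \<Sum>i\<in>Basis. blinfun_apply (f' x) i *\<^sub>R i)"
    by (intro continuous_intros f'(2))
  ultimately show "(\<forall>x\<in>S. (f has_derivative (\<lambda>h. grad f x \<bullet> h)) (at x)) \<and> continuous_on S (grad f)"
    using grad_has_derivative[OF f'(1)] by blast
next
  assume *: "(\<forall>x\<in>S. (f has_derivative (\<lambda>h. grad f x \<bullet> h)) (at x)) \<and> continuous_on S (grad f)"
  show "C1_on S f"
    unfolding C1_on_def
  proof (intro exI[of _ "\<lambda>x. blinfun_inner_right (grad f x)"] conjI ballI)
    show "continuous_on S (\<lambda>x. blinfun_inner_right (grad f x))"
      using * bounded_linear.continuous_on[OF bounded_linear_blinfun_inner_right] by blast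
  qed (use * in \<open>auto intro: has_derivative_at_withinI\<close>)
qed

lemma C1_on_gradI:
  fixes S :: "'a::euclidean_space set"
  assumes "open S" "\<And>x. x \<in> S \<Longrightarrow> (f has_derivative (\<lambda>h. d x \<bullet> h)) (at x)" "continuous_on S d"
  shows "C1_on S f"
proof -
  have "continuous_on S (grad f) \<longleftrightarrow> continuous_on S d"
    using assms(2) by (intro continuous_on_cong) (simp_all add: grad_eqI)
  thus ?thesis unfolding C1_on_open_iff[OF assms(1)] using assms grad_eqI by metis
qed

lemma C1_on_localI:
  fixes S :: "'a::euclidean_space set"
  assumes S: "open S"
    and loc: "\<And>x. x \<in> S \<Longrightarrow> \<exists>T g. open T \<and> x \<in> T \<and> C1_on T g \<and> (\<forall>y\<in>T. f y = g y)"
  shows "C1_on S f"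
proof -
  have "(f has_derivative (\<lambda>h. grad f x \<bullet> h)) (at x) \<and> continuous (at x) (grad f)" if x: "x \<in> S" for x
  proof -
    obtain T g where T: "open T" "x \<in> T" "C1_on T g" "\<And>y. y \<in> T \<Longrightarrow> f y = g y"
      using loc[OF x] by blast
    have eq: "grad f y = grad g y" if "y \<in> T" for y
      by (rule grad_cong[OF T(1) that T(4)])
    have "(g has_derivative (\<lambda>h. grad f x \<bullet> h)) (at x)"
      using T C1_on_open_iff eq by metis
    hence "(f has_derivative (\<lambda>h. grad f x \<bullet> h)) (at x)"
      using has_derivative_transform_within_open[of g _ x UNIV T f] T by simp
    moreover have "continuous_on T (grad g)" using T(3) unfolding C1_on_open_iff[OF T(1)] ..
    hence "continuous_on T (grad f)" by (simp add: eq cong: continuous_on_cong_simp)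
    hence "continuous (at x) (grad f)" using T by (simp add: continuous_on_eq_continuous_at)
    ultimately show ?thesis by blast
  qed
  thus ?thesis
    unfolding C1_on_open_iff[OF S] by (simp add: continuous_on_eq_continuous_at[OF S])
qed

text \<open>Regularity of a glued function is obtained from open pieces on which it coincides with a
  known \<open>C2\<close> function.\<close>

lemma C2_on_localI:
  assumes S: "open S"
    and loc: "\<And>x. x \<in> S \<Longrightarrow> \<exists>T g. open T \<and> x \<in> T \<and> C2_on T g \<and> (\<forall>y\<in>T. f y = g y)"
  shows "C2_on S f"
  unfolding C2_on_def
proof (intro conjI ballI)
  show "C1_on S f"
  proof (rule C1_on_localI[OF S])
    fix x assume "x \<in> S"
    from loc[OF this] show "\<exists>T g. open T \<and> x \<in> T \<and> C1_on T g \<and> (\<forall>y\<in>T. f y = g y)"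
      unfolding C2_on_def by blast
  qed
  fix i :: 'a assume i: "i \<in> Basis"
  show "C1_on S (partial_deriv i f)"
  proof (rule C1_on_localI[OF S])
    fix x assume "x \<in> S"
    from loc[OF this]
    obtain T g where T: "open T" "x \<in> T" "C2_on T g" "\<And>y. y \<in> T \<Longrightarrow> f y = g y" by blast
    thus "\<exists>T g. open T \<and> x \<in> T \<and> C1_on T g \<and> (\<forall>y\<in>T. partial_deriv i f y = g y)"
      using i partial_deriv_cong[OF T(1) _ T(4)]
      by (intro exI[of _ T] exI[of _ "partial_deriv i g"]) (auto simp: C2_on_def)
  qed
qed

section \<open>Gradient, Laplacian and regularity of radial functions away from the origin\<close>

lemma radial_has_derivative:
  fixes x :: "'a::euclidean_space"
  assumes "x \<noteq> 0" "(U has_real_derivative d) (at (norm x))"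
  shows "((\<lambda>x. U (norm x)) has_derivative (\<lambda>h. ((d / norm x) *\<^sub>R x) \<bullet> h)) (at x)"
proof -
  have "((\<lambda>x::'a. norm x) has_derivative (\<lambda>h. h \<bullet> sgn x)) (at x)"
    using has_derivative_norm[OF assms(1)] by simp
  from has_derivative_compose[OF this assms(2)[unfolded has_field_derivative_def]]
  show ?thesis by (simp add: sgn_div_norm inner_commute divide_inverse mult_ac)
qed

lemma radial_grad:
  fixes x :: "'a::euclidean_space"
  assumes "x \<noteq> 0" "(U has_real_derivative d) (at (norm x))"
  shows "grad (\<lambda>x. U (norm x)) x = (d / norm x) *\<^sub>R x"
  by (rule grad_eqI[OF radial_has_derivative[OF assms]])

lemma radial_partial_deriv:
  fixes x :: "'a::euclidean_space"
  assumes "x \<noteq> 0" "(U has_real_derivative d) (at (norm x))"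
  shows "partial_deriv i (\<lambda>x. U (norm x)) x = d / norm x * (x \<bullet> i)"
  by (simp add: partial_deriv_eqI[OF radial_has_derivative[OF assms]])

lemma open_annulus: "open {x::'a::euclidean_space. \<alpha> < norm x \<and> norm x < \<beta>}"
  by (intro open_Collect_conj open_Collect_less continuous_intros)

context
  fixes U W W' :: "real \<Rightarrow> real" and \<alpha> \<beta> :: real
  assumes \<alpha>: "0 \<le> \<alpha>"
    and U: "\<And>r. \<alpha> < r \<Longrightarrow> r < \<beta> \<Longrightarrow> (U has_real_derivative W r) (at r)"
    and W: "\<And>r. \<alpha> < r \<Longrightarrow> r < \<beta> \<Longrightarrow> (W has_real_derivative W' r) (at r)"
begin

text \<open>Product rule for \<open>(W r / r) * (x \<bullet> i)\<close>: the multiple of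
  \<open>i\<close> comes from the linear factor, the multiple of \<open>x\<close> from the radial
  one.\<close>

lemma radial_partial_deriv_has_derivative:
  fixes x i :: "'a::euclidean_space"
  assumes x: "\<alpha> < norm x" "norm x < \<beta>"
  defines "r \<equiv> norm x"
  shows "(partial_deriv i (\<lambda>x. U (norm x)) has_derivative
    (\<lambda>h. ((W r / r) *\<^sub>R i + ((x \<bullet> i) * ((W' r * r - W r) / (r * r)) / r) *\<^sub>R x) \<bullet> h)) (at x)"
proof -
  define T where "T = {x::'a. \<alpha> < norm x \<and> norm x < \<beta>}"
  have T: "open T" "x \<in> T" unfolding T_def using x open_annulus by auto
  have x0: "x \<noteq> 0" and r: "r > 0" using x \<alpha> by (auto simp: r_def)
  have "((\<lambda>r. W r / r) has_real_derivative (W' r * r - W r) / (r * r)) (at r)"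
    using DERIV_divide[OF W[OF x] DERIV_ident] r by (simp add: r_def)
  from radial_has_derivative[OF x0 this[unfolded r_def]]
  have "((\<lambda>x. W (norm x) / norm x * (x \<bullet> i)) has_derivative
     (\<lambda>h. ((W r / r) *\<^sub>R i + ((x \<bullet> i) * ((W' r * r - W r) / (r * r)) / r) *\<^sub>R x) \<bullet> h)) (at x)"
    by (rule has_derivative_eq_rhs[OF has_derivative_mult
          [OF _ bounded_linear_imp_has_derivative[OF bounded_linear_inner_left]]])
       (auto simp: r_def inner_add_left inner_commute algebra_simps)
  moreover have "W (norm y) / norm y * (y \<bullet> i) = partial_deriv i (\<lambda>x. U (norm x)) y" if "y \<in> T" for y
    using that \<alpha> by (intro radial_partial_deriv[symmetric] U) (auto simp: T_def)
  ultimately show ?thesis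
    using has_derivative_transform_within_open[OF _ T] by blast
qed

lemma radial_laplacian:
  fixes x :: "'a::euclidean_space"
  assumes x: "\<alpha> < norm x" "norm x < \<beta>"
  shows "laplacian (\<lambda>x. U (norm x)) x = W' (norm x) + real (DIM('a) - 1) / norm x * W (norm x)"
proof -
  define r where "r = norm x"
  have r: "r > 0" using x \<alpha> by (auto simp: r_def)
  \<comment> \<open>The coefficient of the rank-one part of the Hessian; it contributes
    \<open>c * r^2\<close> to the trace, the identity part contributes
    \<open>DIM('a) * (W r / r)\<close>.\<close>
  define c where "c = (W' r * r - W r) / (r * r) / r"
  have "laplacian (\<lambda>x. U (norm x)) x =
      (\<Sum>i\<in>Basis. ((W r / r) *\<^sub>R i + ((x \<bullet> i) * ((W' r * r - W r) / (r * r)) / r) *\<^sub>R x) \<bullet> i)"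
    unfolding laplacian_def r_def
    by (intro sum.cong refl partial_deriv_eqI[OF radial_partial_deriv_has_derivative[OF x]])
  also have "\<dots> = (\<Sum>i\<in>(Basis::'a set). W r / r + c * ((x \<bullet> i) * (x \<bullet> i)))"
    by (intro sum.cong refl) (simp add: inner_add_left c_def field_simps)
  also have "\<dots> = real DIM('a) * (W r / r) + c * (r * r)"
    by (simp add: sum.distrib sum_distrib_left[symmetric] euclidean_inner[symmetric]
        r_def power2_norm_eq_inner[symmetric] power2_eq_square)
  also have "\<dots> = W' r + real (DIM('a) - 1) / r * W r"
    using r by (simp add: c_def field_simps of_nat_diff)
  finally show ?thesis by (simp add: r_def)
qed

lemma radial_C2_on:
  assumes "continuous_on {\<alpha><..<\<beta>} W'"
  shows "C2_on {x::'a::euclidean_space. \<alpha> < norm x \<and> norm x < \<beta>} (\<lambda>x. U (norm x))"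
proof -
  define T where "T = {x::'a. \<alpha> < norm x \<and> norm x < \<beta>}"
  have T: "open T" unfolding T_def by (rule open_annulus)
  have W_cont: "continuous_on {\<alpha><..<\<beta>} W"
    using W by (intro DERIV_continuous_on) (auto intro: DERIV_subset)
  have c: "continuous_on T (\<lambda>x. W (norm x))" "continuous_on T (\<lambda>x. W' (norm x))"
    by (rule continuous_on_compose2[OF W_cont continuous_on_norm_id]
             continuous_on_compose2[OF assms continuous_on_norm_id]; auto simp: T_def)+
  have n: "norm x > 0" if "x \<in> T" for x using that \<alpha> by (auto simp: T_def)
  show ?thesis
    unfolding C2_on_def T_def[symmetric]
  proof (intro conjI ballI)
    show "C1_on T (\<lambda>x. U (norm x))"
    proof (rule C1_on_gradI[OF T])
      show "((\<lambda>x. U (norm x)) has_derivative (\<lambda>h. ((W (norm x) / norm x) *\<^sub>R x) \<bullet> h)) (at x)"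
        if "x \<in> T" for x
        using that \<alpha> by (intro radial_has_derivative U) (auto simp: T_def)
      show "continuous_on T (\<lambda>x. (W (norm x) / norm x) *\<^sub>R x)"
        using n by (intro continuous_intros c) force
    qed
    fix i :: 'a
    show "C1_on T (partial_deriv i (\<lambda>x. U (norm x)))"
    proof (rule C1_on_gradI[OF T radial_partial_deriv_has_derivative])
      show "continuous_on T (\<lambda>x. (W (norm x) / norm x) *\<^sub>R i + ((x \<bullet> i) *
          ((W' (norm x) * norm x - W (norm x)) / (norm x * norm x)) / norm x) *\<^sub>R x)"
        using n by (intro continuous_intros c) force+
    qed (auto simp: T_def)
  qed
qed

end

section \<open>One-dimensional profiles of radial functions\<close>

lemma axis_has_real_derivative:
  fixes e :: "'a::euclidean_space"
  assumes "C1_on (ball 0 R) u" "e \<in> Basis" "\<bar>r\<bar> < R"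
  shows "((\<lambda>r. u (r *\<^sub>R e)) has_real_derivative partial_deriv e u (r *\<^sub>R e)) (at r)"
proof -
  have "(u has_derivative (\<lambda>h. grad u (r *\<^sub>R e) \<bullet> h)) (at (r *\<^sub>R e))"
    using assms C1_on_open_iff[of "ball 0 R" u] by simp
  moreover from partial_deriv_eqI[OF this]
  have "partial_deriv e u (r *\<^sub>R e) = grad u (r *\<^sub>R e) \<bullet> e" .
  moreover have "((\<lambda>r. r *\<^sub>R e) has_derivative (\<lambda>h. h *\<^sub>R e)) (at r)"
    by (auto intro!: derivative_eq_intros)
  ultimately show ?thesis
    using has_derivative_compose[of "\<lambda>r. r *\<^sub>R e" "\<lambda>h. h *\<^sub>R e" r UNIV u "\<lambda>h. grad u (r *\<^sub>R e) \<bullet> h"]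
    by (simp add: has_field_derivative_def mult_commute_abs)
qed

lemma even_deriv_zero:
  fixes U :: "real \<Rightarrow> real"
  assumes "(U has_real_derivative d) (at 0)" "R > 0" "\<And>r. \<bar>r\<bar> < R \<Longrightarrow> U (- r) = U r"
  shows "d = 0"
proof -
  have "((\<lambda>r. U (- r)) has_real_derivative - d) (at 0)"
    using DERIV_chain2[of U d uminus 0 "-1" UNIV, OF _ DERIV_minus[OF DERIV_ident]] assms(1) by simp
  moreover have "((\<lambda>r. U (- r)) has_real_derivative d) (at 0)"
    using assms
    by (intro has_field_derivative_transform_within_open[OF assms(1), of "{-R<..<R}"]) auto
  ultimately have "- d = d" by (rule DERIV_unique)
  thus ?thesis by simp
qed

text \<open>The profile is the restriction of \<open>u\<close> to the line through a basis vector.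
  Admitting negative \<open>r\<close> makes the derivatives at \<open>0\<close> two-sided, and
  evenness then gives \<open>W 0 = 0\<close>. The last two formulas leave out the origin, where
  \<open>norm\<close> is not differentiable.\<close>

lemma radial_profile:
  fixes u :: "'a::euclidean_space \<Rightarrow> real"
  assumes R: "R > 0" and C2: "C2_on (ball 0 R) u" and rad: "radial_on R u"
  obtains U W W' where
    "\<And>x. x \<in> ball 0 R \<Longrightarrow> u x = U (norm x)"
    "\<And>r. \<bar>r\<bar> < R \<Longrightarrow> (U has_real_derivative W r) (at r)"
    "\<And>r. \<bar>r\<bar> < R \<Longrightarrow> (W has_real_derivative W' r) (at r)"
    "W 0 = 0"
    "\<And>x. x \<in> ball 0 R \<Longrightarrow> x \<noteq> 0 \<Longrightarrow>
       laplacian u x = W' (norm x) + real (DIM('a) - 1) / norm x * W (norm x)"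
    "\<And>x. x \<in> ball 0 R \<Longrightarrow> x \<noteq> 0 \<Longrightarrow> norm (grad u x) = \<bar>W (norm x)\<bar>"
proof -
  obtain e :: 'a where e: "e \<in> Basis" by (rule that[OF SOME_Basis])
  define U where "U = (\<lambda>r. u (r *\<^sub>R e))"
  define W where "W = (\<lambda>r. partial_deriv e u (r *\<^sub>R e))"
  define W' where "W' = (\<lambda>r. partial_deriv e (partial_deriv e u) (r *\<^sub>R e))"
  have radD: "u x = u y" if "x \<in> ball 0 R" "y \<in> ball 0 R" "norm x = norm y" for x y
    using rad that unfolding radial_on_def by blast
  have eq: "u x = U (norm x)" if "x \<in> ball 0 R" for x
    unfolding U_def by (rule radD) (use that e in auto)
  have U: "(U has_real_derivative W r) (at r)" if "\<bar>r\<bar> < R" for r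
    unfolding U_def W_def using C2 e that by (intro axis_has_real_derivative) (auto simp: C2_on_def)
  have W: "(W has_real_derivative W' r) (at r)" if "\<bar>r\<bar> < R" for r
    unfolding W_def W'_def using C2 e that
    by (intro axis_has_real_derivative) (auto simp: C2_on_def)
  have W0: "W 0 = 0"
  proof (rule even_deriv_zero[OF U R])
    fix r assume "\<bar>r\<bar> < R"
    thus "U (- r) = U r" unfolding U_def using e by (intro radD) auto
  qed (use R in simp)
  have lap: "laplacian u x = W' (norm x) + real (DIM('a) - 1) / norm x * W (norm x)"
    if "x \<in> ball 0 R" "x \<noteq> 0" for x
  proof -
    have "laplacian u x = laplacian (\<lambda>x. U (norm x)) x"
      by (rule laplacian_cong[OF open_ball that(1) eq])
    also have "\<dots> = W' (norm x) + real (DIM('a) - 1) / norm x * W (norm x)"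
      by (rule radial_laplacian[of 0 R]) (use U W that in auto)
    finally show ?thesis .
  qed
  have gr: "norm (grad u x) = \<bar>W (norm x)\<bar>" if "x \<in> ball 0 R" "x \<noteq> 0" for x
  proof -
    have "grad u x = grad (\<lambda>x. U (norm x)) x"
      by (rule grad_cong[OF open_ball that(1) eq])
    also have "\<dots> = (W (norm x) / norm x) *\<^sub>R x"
      by (rule radial_grad) (use U that in auto)
    finally show ?thesis using that by simp
  qed
  from that[OF eq U W W0 lap gr] show thesis .
qed

text \<open>The equation below says that \<open>(r\<^sup>m y)' = r\<^sup>m k\<close>.\<close>

context
  fixes y y' k :: "real \<Rightarrow> real" and m :: nat and R :: real
  assumes y: "\<And>r. \<bar>r\<bar> < R \<Longrightarrow> (y has_real_derivative y' r) (at r)"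
    and y0: "y 0 = 0"
    and eq: "\<And>r. 0 < r \<Longrightarrow> r < R \<Longrightarrow> y' r = k r - real m / r * y r"
begin

lemma flux_deriv:
  assumes "0 < r" "r < R"
  shows "((\<lambda>r. r ^ m * y r) has_real_derivative r ^ m * k r) (at r)"
proof -
  have "((\<lambda>r. r ^ m * y r) has_real_derivative real m * r ^ (m - 1) * y r + r ^ m * y' r) (at r)"
    using y[of r] assms by (auto intro!: derivative_eq_intros)
  moreover have "real m * r ^ (m - 1) * y r + r ^ m * y' r = r ^ m * k r"
    using assms by (cases m) (simp_all add: eq field_simps)
  ultimately show ?thesis by simp
qed

lemma flux_cont: "r < R \<Longrightarrow> continuous_on {0..r} y"
  by (intro DERIV_continuous_on[where D=y'] DERIV_subset[OF y]) auto

lemma flux_nonneg: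
  assumes k: "\<And>r. 0 < r \<Longrightarrow> r < R \<Longrightarrow> 0 \<le> k r" and r: "0 \<le> r" "r < R"
  shows "0 \<le> y r"
proof (cases "r = 0")
  case False
  \<comment> \<open>For \<open>m = 0\<close> the factor \<open>0 ^ m\<close> equals
    \<open>1\<close>; the left side is zero in all cases because \<open>y 0 = 0\<close>.\<close>
  have "0 ^ m * y 0 \<le> r ^ m * y r"
  proof (rule DERIV_nonneg_imp_increasing_open[OF r(1)])
    fix x assume "0 < x" "x < r"
    thus "\<exists>z. ((\<lambda>r. r ^ m * y r) has_real_derivative z) (at x) \<and> 0 \<le> z"
      using flux_deriv[of x] k[of x] r by (intro exI[of _ "x ^ m * k x"]) auto
  qed (intro continuous_intros flux_cont r)
  moreover have "0 < r ^ m" using r False by simp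
  ultimately show ?thesis using y0 by (simp add: zero_le_mult_iff)
qed (simp add: y0)

text \<open>For a nondecreasing source the flux \<open>r ^ m * y r\<close> is at most that of the
  constant source \<open>k r\<close>, so \<open>y r \<le> r * k r / (m + 1)\<close>. The drift term
  then takes away at most the fraction \<open>m / (m + 1)\<close> of \<open>k r\<close>. This is how
  the first-order part of the Laplacian costs only a constant.\<close>

lemma flux_bounds:
  assumes k: "\<And>r. 0 < r \<Longrightarrow> r < R \<Longrightarrow> 0 \<le> k r"
    and k_mono: "\<And>s r. 0 < s \<Longrightarrow> s \<le> r \<Longrightarrow> r < R \<Longrightarrow> k s \<le> k r"
    and r: "0 < r" "r < R"
  shows "k r / real (Suc m) \<le> y' r" "y' r \<le> k r"
proof -
  have "0 ^ Suc m * (k r / real (Suc m)) - 0 ^ m * y 0 \<le> r ^ Suc m * (k r / real (Suc m)) - r ^ m * y r"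
  proof (rule DERIV_nonneg_imp_increasing_open[of 0 r "\<lambda>t. t ^ Suc m * (k r / real (Suc m)) - t ^ m * y t"])
    fix x assume x: "0 < x" "x < r"
    have "((\<lambda>t. t ^ Suc m * (k r / real (Suc m))) has_real_derivative x ^ m * k r) (at x)"
      using DERIV_cmult_right[OF DERIV_pow[of "Suc m" x UNIV], of "k r / real (Suc m)"]
      by (simp del: of_nat_Suc)
    from DERIV_diff[OF this flux_deriv[OF x(1)]]
    have "((\<lambda>t. t ^ Suc m * (k r / real (Suc m)) - t ^ m * y t) has_real_derivative
        x ^ m * (k r - k x)) (at x)"
      using x r by (simp add: algebra_simps)
    moreover have "0 \<le> x ^ m * (k r - k x)" using k_mono[of x r] x r by simp
    ultimately show "\<exists>z. ((\<lambda>t. t ^ Suc m * (k r / real (Suc m)) - t ^ m * y t) has_real_derivative z) (at x) \<and> 0 \<le> z"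
      by blast
  qed (use r in \<open>auto intro!: continuous_intros flux_cont\<close>)
  hence "r ^ m * y r \<le> r ^ m * (r * (k r / real (Suc m)))" using y0 by (simp add: mult_ac)
  hence le: "y r \<le> r * (k r / real (Suc m))"
    by (rule mult_left_le_imp_le) (use r in simp)
  have "real m / r * y r \<le> real m / r * (r * (k r / real (Suc m)))"
    using r by (intro mult_left_mono le) auto
  also have "\<dots> = k r - k r / real (Suc m)" using r by (simp add: field_simps)
  finally show "k r / real (Suc m) \<le> y' r" using eq[OF r] by simp
  have "0 \<le> real m / r * y r" using flux_nonneg[OF k] r by simp
  thus "y' r \<le> k r" using eq[OF r] by simp
qed

end

section \<open>Continuation of solutions of ordinary differential equations\<close>

lemma continuous_on_graph:
  assumes "continuous_on (A \<times> UNIV) (\<lambda>(t, x). F t x)" "continuous_on B \<phi>" "B \<subseteq> A"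
  shows "continuous_on B (\<lambda>s. F s (\<phi> s))"
proof -
  have "continuous_on B (\<lambda>s. (s, \<phi> s))" by (intro continuous_intros assms(2))
  from continuous_on_compose2[OF assms(1) this] show ?thesis using assms(3) by auto
qed

text \<open>Banach's fixed point theorem in the complete space of bounded continuous functions on
  the whole line; \<open>clamp\<close> extends the integral operator constantly beyond the interval.
  The Lipschitz bound is global in \<open>x\<close>, so no invariant ball has to be found.\<close>

lemma picard_local:
  fixes F :: "real \<Rightarrow> 'a::banach \<Rightarrow> 'a"
  assumes t0: "t0 < T"
    and cont: "continuous_on ({t0..T} \<times> UNIV) (\<lambda>(t, x). F t x)"
    and lip: "\<And>t x y. t \<in> {t0..T} \<Longrightarrow> norm (F t x - F t y) \<le> L * norm (x - y)"
  obtains d y where "0 < d" "t0 + d \<le> T" "continuous_on {t0..t0+d} y"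
    "\<And>t. t \<in> {t0..t0+d} \<Longrightarrow> y t = x0 + integral {t0..t} (\<lambda>s. F s (y s))"
proof -
  \<comment> \<open>\<open>L\<close> may be zero or negative; \<open>K\<close> is a positive
    substitute by which the step size can be divided.\<close>
  define K where "K = \<bar>L\<bar> + 1"
  have K: "K > 0" "L \<le> K" unfolding K_def by auto
  define d where "d = min (T - t0) (1 / (2 * K))"
  have d: "0 < d" "t0 + d \<le> T" "K * d \<le> 1 / 2"
    using t0 K(1) by (auto simp: d_def min_def field_simps)
  have F_cont: "continuous_on {t0..t0+d} (\<lambda>s. F s (\<phi> s))" if "continuous_on {t0..t0+d} \<phi>" for \<phi>
    by (rule continuous_on_graph[OF cont that]) (use d in auto)
  have "\<exists>\<psi> :: real \<Rightarrow>\<^sub>C 'a. \<forall>t. \<psi> t = x0 + integral {t0..clamp t0 (t0+d) t} (\<lambda>s. F s (\<phi> s))"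
    for \<phi> :: "real \<Rightarrow>\<^sub>C 'a"
  proof -
    have "continuous_on (cbox t0 (t0+d)) (\<lambda>t. x0 + integral {t0..t} (\<lambda>s. F s (\<phi> s)))"
      unfolding box_real
      by (intro continuous_intros indefinite_integral_continuous_1 integrable_continuous_real F_cont) auto
    from continuous_on_cbox_bcontfunE[OF this] show ?thesis by metis
  qed
  then obtain P :: "(real \<Rightarrow>\<^sub>C 'a) \<Rightarrow> (real \<Rightarrow>\<^sub>C 'a)"
    where P: "\<And>\<phi> t. P \<phi> t = x0 + integral {t0..clamp t0 (t0+d) t} (\<lambda>s. F s (\<phi> s))"
    by metis
  have "dist (P \<phi>) (P \<psi>) \<le> 1 / 2 * dist \<phi> \<psi>" for \<phi> \<psi>
  proof (rule dist_bound)
    fix t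
    define t' where "t' = clamp t0 (t0+d) t"
    have t': "t0 \<le> t'" "t' \<le> t0 + d"
      using clamp_in_interval[of t0 "t0+d" t] d by (auto simp: t'_def)
    have i: "(\<lambda>s. F s (\<phi> s)) integrable_on {t0..t'}" for \<phi> :: "real \<Rightarrow>\<^sub>C 'a"
      by (intro integrable_continuous_real continuous_on_subset[OF F_cont]) (use t' in auto)
    have "P \<phi> t - P \<psi> t = integral {t0..t'} (\<lambda>s. F s (\<phi> s) - F s (\<psi> s))"
      using integral_diff[OF i i, of \<phi> \<psi>] by (simp add: P t'_def)
    also have "norm \<dots> \<le> integral {t0..t'} (\<lambda>s. K * dist \<phi> \<psi>)"
    proof (rule integral_norm_bound_integral)
      fix s assume s: "s \<in> {t0..t'}"
      have "norm (F s (\<phi> s) - F s (\<psi> s)) \<le> L * norm (\<phi> s - \<psi> s)"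
        using s t' d by (intro lip) auto
      also have "\<dots> \<le> K * dist (\<phi> s) (\<psi> s)"
        using K by (simp add: dist_norm mult_right_mono)
      also have "\<dots> \<le> K * dist \<phi> \<psi>" using K dist_bounded by (intro mult_left_mono) auto
      finally show "norm (F s (\<phi> s) - F s (\<psi> s)) \<le> K * dist \<phi> \<psi>" .
    qed (intro integrable_diff i integrable_const_ivl)+
    also have "\<dots> = (K * (t' - t0)) * dist \<phi> \<psi>" using t' by simp
    also have "\<dots> \<le> (K * d) * dist \<phi> \<psi>" using K t' by (intro mult_right_mono mult_left_mono) auto
    also have "\<dots> \<le> 1 / 2 * dist \<phi> \<psi>" using d(3) by (intro mult_right_mono) auto
    finally show "dist (P \<phi> t) (P \<psi> t) \<le> 1 / 2 * dist \<phi> \<psi>" by (simp add: dist_norm)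
  qed
  hence "\<exists>!\<phi>. P \<phi> = \<phi>" by (intro banach_fix_type[of "1/2"]) auto
  then obtain \<phi> where \<phi>: "P \<phi> = \<phi>" by blast
  have "\<phi> t = x0 + integral {t0..t} (\<lambda>s. F s (\<phi> s))" if "t \<in> {t0..t0+d}" for t
    using P[of \<phi> t] \<phi> that by simp
  thus thesis using that[of d \<phi>] d by auto
qed

text \<open>A bounded orbit has bounded velocity, hence is Lipschitz and extends continuously to
  \<open>R\<close>; the limit is the initial value for a Picard solution to the right of
  \<open>R\<close>.\<close>

lemma ode_extension:
  fixes F :: "real \<Rightarrow> 'a::euclidean_space \<Rightarrow> 'a"
  assumes r0: "r0 < R" "R < T"
    and cont: "continuous_on ({r0..T} \<times> UNIV) (\<lambda>(t, x). F t x)"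
    and lip: "\<And>t x y. t \<in> {r0..T} \<Longrightarrow> norm (F t x - F t y) \<le> L * norm (x - y)"
    and y: "\<And>t. r0 \<le> t \<Longrightarrow> t < R \<Longrightarrow> (y has_vector_derivative F t (y t)) (at t)"
    and y_bdd: "\<And>t. r0 \<le> t \<Longrightarrow> t < R \<Longrightarrow> norm (y t) \<le> B"
  obtains d z where "0 < d" "R + d \<le> T" "continuous_on {r0..R+d} z"
    "\<And>t. r0 \<le> t \<Longrightarrow> t < R \<Longrightarrow> z t = y t"
    "\<And>t. r0 < t \<Longrightarrow> t < R + d \<Longrightarrow> (z has_vector_derivative F t (z t)) (at t)"
proof -
  have "compact ((\<lambda>(t, x). F t x) ` ({r0..R} \<times> cball 0 B))"
    by (intro compact_continuous_image continuous_on_subset[OF cont] compact_Times) (use r0 in auto)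
  from compact_imp_bounded[OF this]
  obtain M where M0: "\<And>v. v \<in> (\<lambda>(t, x). F t x) ` ({r0..R} \<times> cball 0 B) \<Longrightarrow> norm v \<le> M"
    unfolding bounded_iff by blast
  have M: "norm (F t x) \<le> M" if "t \<in> {r0..R}" "norm x \<le> B" for t x
    using M0[of "F t x"] that by force
  have "\<bar>M\<bar>-lipschitz_on {r0..<R} y"
  proof (rule bounded_derivative_imp_lipschitz)
    fix t assume t: "t \<in> {r0..<R}"
    show "(y has_derivative (\<lambda>h. h *\<^sub>R F t (y t))) (at t within {r0..<R})"
      using y[of t] t unfolding has_vector_derivative_def by (auto intro: has_derivative_at_withinI)
    show "onorm (\<lambda>h. h *\<^sub>R F t (y t)) \<le> \<bar>M\<bar>"
    proof (rule onorm_le)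
      fix h :: real
      have le: "norm (F t (y t)) \<le> \<bar>M\<bar>" using M[of t "y t"] y_bdd[of t] t by auto
      thus "norm (h *\<^sub>R F t (y t)) \<le> \<bar>M\<bar> * norm h"
        using mult_right_mono[OF le abs_ge_zero[of h]] by (simp add: mult.commute)
    qed
  qed auto
  hence uc: "uniformly_continuous_on {r0..<R} y" by (rule lipschitz_on_uniformly_continuous)
  obtain g where g: "uniformly_continuous_on (closure {r0..<R}) g" "\<And>x. x \<in> {r0..<R} \<Longrightarrow> y x = g x"
    by (rule uniformly_continuous_on_extension_on_closure[OF uc]) (rule that)
  have g_cont: "continuous_on {r0..R} g"
    using uniformly_continuous_imp_continuous[OF g(1)] r0 by simp
  have "continuous_on ({R..T} \<times> UNIV) (\<lambda>(t, x). F t x)"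
    by (rule continuous_on_subset[OF cont]) (use r0 in auto)
  then obtain d x where d: "0 < d" "R + d \<le> T" and x: "continuous_on {R..R+d} x"
    "\<And>t. t \<in> {R..R+d} \<Longrightarrow> x t = g R + integral {R..t} (\<lambda>s. F s (x s))"
    by (rule picard_local[OF r0(2), where ?x0.0 = "g R" and L = L]) (use lip r0 in auto)
  have xR: "x R = g R" using x(2)[of R] d by simp
  define z where "z t = (if t \<le> R then g t else x t)" for t
  have z_cont: "continuous_on {r0..R+d} z"
    unfolding z_def
    by (rule continuous_on_cases_1)
       (use xR r0 in \<open>auto intro: continuous_on_subset[OF g_cont] continuous_on_subset[OF x(1)]\<close>)
  have zy: "z t = y t" if "r0 \<le> t" "t < R" for t using that g(2)[of t] by (simp add: z_def)
  define \<Phi> where "\<Phi> s = F s (z s)" for s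
  have \<Phi>_cont: "continuous_on {r0..R+d} \<Phi>"
    unfolding \<Phi>_def
    by (rule continuous_on_graph[OF cont z_cont]) (use d in auto)
  have left: "z t = z r0 + integral {r0..t} \<Phi>" if t: "r0 \<le> t" "t \<le> R" for t
  proof -
    have "(\<Phi> has_integral z t - z r0) {r0..t}"
    proof (rule fundamental_theorem_of_calculus_interior[OF t(1)])
      show "continuous_on {r0..t} z" by (rule continuous_on_subset[OF z_cont]) (use t d in auto)
      fix s assume s: "s \<in> {r0<..<t}"
      have "(y has_vector_derivative \<Phi> s) (at s)" using y[of s] zy[of s] s t by (simp add: \<Phi>_def)
      thus "(z has_vector_derivative \<Phi> s) (at s)"
        using s t zy
        by (intro has_vector_derivative_transform_within_open[of y "\<Phi> s" s "{r0<..<R}" z]) auto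
    qed
    from integral_unique[OF this] show ?thesis by simp
  qed
  \<comment> \<open>At \<open>R\<close> neither piece has a two-sided derivative of its own. The
    integral equation over the junction, with a continuous integrand, provides it.\<close>
  have all: "z t = z r0 + integral {r0..t} \<Phi>" if t: "t \<in> {r0..R+d}" for t
  proof (cases "t \<le> R")
    case False
    have "integral {R..t} (\<lambda>s. F s (x s)) = integral {R..t} \<Phi>"
      using xR by (intro integral_cong) (auto simp: \<Phi>_def z_def)
    hence "z t = z R + integral {R..t} \<Phi>" using x(2)[of t] False t by (simp add: z_def)
    also have "\<dots> = z r0 + (integral {r0..R} \<Phi> + integral {R..t} \<Phi>)"
      using left[of R] r0 by simp
    also have "integral {r0..R} \<Phi> + integral {R..t} \<Phi> = integral {r0..t} \<Phi>"
      by (rule Henstock_Kurzweil_Integration.integral_combine)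
         (use False t r0 d in \<open>auto intro!: integrable_continuous_real continuous_on_subset[OF \<Phi>_cont]\<close>)
    finally show ?thesis .
  next
    case True
    thus ?thesis using t by (intro left) auto
  qed
  have "(z has_vector_derivative F t (z t)) (at t)" if t: "r0 < t" "t < R + d" for t
  proof -
    have "((\<lambda>t. z r0 + integral {r0..t} \<Phi>) has_vector_derivative \<Phi> t) (at t within {r0..R+d})"
      using has_vector_derivative_add[OF has_vector_derivative_const integral_has_vector_derivative[OF \<Phi>_cont, of t]]
        t by simp
    moreover have "at t within {r0..R+d} = at t" using t by (intro at_within_interior) auto
    ultimately have "((\<lambda>t. z r0 + integral {r0..t} \<Phi>) has_vector_derivative \<Phi> t) (at t)" by simp
    hence "(z has_vector_derivative \<Phi> t) (at t)"
    proof (rule has_vector_derivative_transform_within_open)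
      show "z r0 + integral {r0..s} \<Phi> = z s" if "s \<in> {r0<..<R+d}" for s
        by (rule all[symmetric]) (use that in auto)
    qed (use t in auto)
    thus ?thesis by (simp add: \<Phi>_def)
  qed
  from that[OF d z_cont zy this] show thesis by blast
qed

lemma has_vector_derivative_PairI:
  assumes "(f has_vector_derivative f') (at x within S)" "(g has_vector_derivative g') (at x within S)"
  shows "((\<lambda>x. (f x, g x)) has_vector_derivative (f', g')) (at x within S)"
  using has_derivative_Pair[OF assms[unfolded has_vector_derivative_def]]
  by (simp add: has_vector_derivative_def)

lemma lipschitz_onD_real:
  fixes P :: "real \<Rightarrow> real"
  shows "L-lipschitz_on UNIV P \<Longrightarrow> \<bar>P x - P y\<bar> \<le> L * \<bar>x - y\<bar>"
  using lipschitz_onD[of L UNIV P x y] by (simp add: dist_real_def)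

text \<open>The two second-order equations as one first-order system in four components, with
  \<open>\<kappa>\<close> in the role of \<open>m / t\<close>. The coefficients need only be
  continuous on \<open>[r0, T]\<close>, so a start at positive \<open>r0\<close> keeps the
  singularity at the origin out.\<close>

lemma system_extension:
  fixes U w V Z P Q \<alpha> \<beta> \<kappa> :: "real \<Rightarrow> real"
  assumes r0: "r0 < R" "R < T"
    and coeff: "continuous_on {r0..T} \<alpha>" "continuous_on {r0..T} \<beta>" "continuous_on {r0..T} \<kappa>"
    and P: "LP-lipschitz_on UNIV P" and Q: "LQ-lipschitz_on UNIV Q"
    and U: "\<And>t. r0 \<le> t \<Longrightarrow> t < R \<Longrightarrow> (U has_real_derivative w t) (at t)"
    and w: "\<And>t. r0 \<le> t \<Longrightarrow> t < R \<Longrightarrow> (w has_real_derivative \<alpha> t * P (V t) - \<kappa> t * w t) (at t)"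
    and V: "\<And>t. r0 \<le> t \<Longrightarrow> t < R \<Longrightarrow> (V has_real_derivative Z t) (at t)"
    and Z: "\<And>t. r0 \<le> t \<Longrightarrow> t < R \<Longrightarrow> (Z has_real_derivative \<beta> t * Q (w t) - \<kappa> t * Z t) (at t)"
    and bdd: "\<And>t. r0 \<le> t \<Longrightarrow> t < R \<Longrightarrow> \<bar>U t\<bar> \<le> B \<and> \<bar>w t\<bar> \<le> B \<and> \<bar>V t\<bar> \<le> B \<and> \<bar>Z t\<bar> \<le> B"
  obtains d U1 w1 V1 Z1 where "0 < d" "R + d \<le> T"
    "continuous_on {r0..R+d} U1" "continuous_on {r0..R+d} w1"
    "continuous_on {r0..R+d} V1" "continuous_on {r0..R+d} Z1"
    "\<And>t. r0 \<le> t \<Longrightarrow> t < R \<Longrightarrow> U1 t = U t \<and> w1 t = w t \<and> V1 t = V t \<and> Z1 t = Z t"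
    "\<And>t. r0 < t \<Longrightarrow> t < R + d \<Longrightarrow> (U1 has_real_derivative w1 t) (at t)"
    "\<And>t. r0 < t \<Longrightarrow> t < R + d \<Longrightarrow> (w1 has_real_derivative \<alpha> t * P (V1 t) - \<kappa> t * w1 t) (at t)"
    "\<And>t. r0 < t \<Longrightarrow> t < R + d \<Longrightarrow> (V1 has_real_derivative Z1 t) (at t)"
    "\<And>t. r0 < t \<Longrightarrow> t < R + d \<Longrightarrow> (Z1 has_real_derivative \<beta> t * Q (w1 t) - \<kappa> t * Z1 t) (at t)"
proof -
  define F :: "real \<Rightarrow> real \<times> real \<times> real \<times> real \<Rightarrow> real \<times> real \<times> real \<times> real" where
    "F t x = (fst (snd x), \<alpha> t * P (fst (snd (snd x))) - \<kappa> t * fst (snd x),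
              snd (snd (snd x)), \<beta> t * Q (fst (snd x)) - \<kappa> t * snd (snd (snd x)))" for t x
  have PQ: "continuous_on UNIV P" "continuous_on UNIV Q"
    using P Q by (auto intro: lipschitz_on_continuous_on)
  have "continuous_on ({r0..T} \<times> UNIV) (\<lambda>z. F (fst z) (snd z))"
    unfolding F_def
    by (intro continuous_intros continuous_on_compose2[OF PQ(1)] continuous_on_compose2[OF PQ(2)]
        continuous_on_compose2[OF coeff(1)] continuous_on_compose2[OF coeff(2)]
        continuous_on_compose2[OF coeff(3)]) auto
  hence cont: "continuous_on ({r0..T} \<times> UNIV) (\<lambda>(t, x). F t x)" by (simp add: case_prod_unfold)
  have "\<exists>C. \<forall>t\<in>{r0..T}. \<bar>f t\<bar> \<le> C" if "continuous_on {r0..T} f" for f :: "real \<Rightarrow> real"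
    using compact_imp_bounded[OF compact_continuous_image[OF that compact_Icc]]
    unfolding bounded_iff by (auto simp: real_norm_def)
  then obtain A1 A2 A3 where A: "\<And>t. t \<in> {r0..T} \<Longrightarrow> \<bar>\<alpha> t\<bar> \<le> A1"
    "\<And>t. t \<in> {r0..T} \<Longrightarrow> \<bar>\<beta> t\<bar> \<le> A2" "\<And>t. t \<in> {r0..T} \<Longrightarrow> \<bar>\<kappa> t\<bar> \<le> A3"
    using coeff by meson
  have L_nonneg: "0 \<le> LP" "0 \<le> LQ" using P Q lipschitz_on_nonneg by blast+
  \<comment> \<open>One unit for each of the components \<open>w\<close> and \<open>Z\<close>,
    \<open>A1 * LP\<close> and \<open>A2 * LQ\<close> for the two sources, and \<open>A3\<close> for
    each of the two drift terms.\<close>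
  have lip: "norm (F t x - F t y) \<le> (2 + A1 * LP + A2 * LQ + 2 * A3) * norm (x - y)"
    if t: "t \<in> {r0..T}" for t x y
  proof -
    define n where "n = norm (x - y)"
    have n: "\<bar>fst (snd x) - fst (snd y)\<bar> \<le> n" "\<bar>fst (snd (snd x)) - fst (snd (snd y))\<bar> \<le> n"
      "\<bar>snd (snd (snd x)) - snd (snd (snd y))\<bar> \<le> n"
      unfolding n_def dist_norm[symmetric] dist_real_def[symmetric]
      using dist_snd_le[of x y] dist_snd_le[of "snd x" "snd y"] dist_fst_le[of "snd x" "snd y"]
        dist_fst_le[of "snd (snd x)" "snd (snd y)"] dist_snd_le[of "snd (snd x)" "snd (snd y)"]
      by linarith+
    have A_nonneg: "0 \<le> A1" "0 \<le> A2" "0 \<le> A3" using A[OF t] by auto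
    have prod: "\<bar>f * g\<bar> \<le> C * D" if "\<bar>f\<bar> \<le> C" "\<bar>g\<bar> \<le> D" "0 \<le> C" for f g C D :: real
      using that by (simp add: abs_mult mult_mono)
    have diff: "\<bar>f - g\<bar> \<le> C + D" if "\<bar>f\<bar> \<le> C" "\<bar>g\<bar> \<le> D" for f g C D :: real
      using that by linarith
    have p: "\<bar>\<alpha> t * (P (fst (snd (snd x))) - P (fst (snd (snd y))))\<bar> \<le> A1 * (LP * n)"
      by (intro prod A t A_nonneg order_trans[OF lipschitz_onD_real[OF P] mult_left_mono[OF n(2) L_nonneg(1)]])
    have q: "\<bar>\<beta> t * (Q (fst (snd x)) - Q (fst (snd y)))\<bar> \<le> A2 * (LQ * n)"
      by (intro prod A t A_nonneg order_trans[OF lipschitz_onD_real[OF Q] mult_left_mono[OF n(1) L_nonneg(2)]])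
    have k: "\<bar>\<kappa> t * (fst (snd x) - fst (snd y))\<bar> \<le> A3 * n"
      "\<bar>\<kappa> t * (snd (snd (snd x)) - snd (snd (snd y)))\<bar> \<le> A3 * n"
      by (intro prod A t A_nonneg n)+
    have "norm (F t x - F t y) \<le> \<bar>fst (snd x) - fst (snd y)\<bar>
      + (\<bar>\<alpha> t * (P (fst (snd (snd x))) - P (fst (snd (snd y)))) - \<kappa> t * (fst (snd x) - fst (snd y))\<bar>
      + (\<bar>snd (snd (snd x)) - snd (snd (snd y))\<bar>
      + \<bar>\<beta> t * (Q (fst (snd x)) - Q (fst (snd y))) - \<kappa> t * (snd (snd (snd x)) - snd (snd (snd y)))\<bar>))"
      unfolding F_def minus_prod_def
      by (simp, intro order_trans[OF norm_Pair_le] add_mono) (simp_all add: algebra_simps)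
    also have "\<dots> \<le> n + ((A1 * (LP * n) + A3 * n) + (n + (A2 * (LQ * n) + A3 * n)))"
      by (intro add_mono n diff p q k)
    also have "\<dots> = (2 + A1 * LP + A2 * LQ + 2 * A3) * n" by (simp add: algebra_simps)
    finally show ?thesis by (simp add: n_def)
  qed
  define y where "y t = (U t, w t, V t, Z t)" for t
  have y: "(y has_vector_derivative F t (y t)) (at t)" if "r0 \<le> t" "t < R" for t
    unfolding y_def F_def
    using U[OF that] w[OF that] V[OF that] Z[OF that]
    by (auto intro!: has_vector_derivative_PairI simp: has_real_derivative_iff_has_vector_derivative)
  have y_bdd: "norm (y t) \<le> B + (B + (B + B))" if "r0 \<le> t" "t < R" for t
    unfolding y_def using bdd[OF that]
    by (intro order_trans[OF norm_Pair_le] add_mono) (auto simp: real_norm_def)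
  obtain d z where d: "0 < d" "R + d \<le> T" and z: "continuous_on {r0..R+d} z"
    "\<And>t. r0 \<le> t \<Longrightarrow> t < R \<Longrightarrow> z t = y t"
    "\<And>t. r0 < t \<Longrightarrow> t < R + d \<Longrightarrow> (z has_vector_derivative F t (z t)) (at t)"
    using ode_extension[OF r0 cont lip y y_bdd] by blast
  note fstD = bounded_linear.has_vector_derivative[OF bounded_linear_fst]
  note sndD = bounded_linear.has_vector_derivative[OF bounded_linear_snd]
  show thesis
  proof (rule that[OF d, of "\<lambda>t. fst (z t)" "\<lambda>t. fst (snd (z t))" "\<lambda>t. fst (snd (snd (z t)))"
        "\<lambda>t. snd (snd (snd (z t)))"])
    fix t assume t: "r0 < t" "t < R + d"
    note zt = z(3)[OF t]
    show "((\<lambda>t. fst (z t)) has_real_derivative fst (snd (z t))) (at t)"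
      using fstD[OF zt] by (simp add: F_def has_real_derivative_iff_has_vector_derivative)
    show "((\<lambda>t. fst (snd (z t))) has_real_derivative
        \<alpha> t * P (fst (snd (snd (z t)))) - \<kappa> t * fst (snd (z t))) (at t)"
      using fstD[OF sndD[OF zt]] by (simp add: F_def has_real_derivative_iff_has_vector_derivative)
    show "((\<lambda>t. fst (snd (snd (z t)))) has_real_derivative snd (snd (snd (z t)))) (at t)"
      using fstD[OF sndD[OF sndD[OF zt]]]
      by (simp add: F_def has_real_derivative_iff_has_vector_derivative)
    show "((\<lambda>t. snd (snd (snd (z t)))) has_real_derivative
        \<beta> t * Q (fst (snd (z t))) - \<kappa> t * snd (snd (snd (z t)))) (at t)"
      using sndD[OF sndD[OF sndD[OF zt]]]
      by (simp add: F_def has_real_derivative_iff_has_vector_derivative)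
  qed (use z in \<open>auto intro!: continuous_intros simp: y_def\<close>)
qed

section \<open>The radial system\<close>

lemma rpow_pos: "x > 0 \<Longrightarrow> rpow x c = x powr c"
  by (simp add: rpow_def)

text \<open>Monotonicity tested at \<open>1\<close> and \<open>2\<close> rules out a negative
  exponent; the signs of \<open>a\<close>, \<open>b\<close> and \<open>p\<close> are recovered from
  admissibility in this way.\<close>

lemma mono_on_rpow_imp_nonneg:
  assumes "mono_on {0..} (\<lambda>r. rpow r c * d)" "d > 0"
  shows "0 \<le> c"
proof (rule ccontr)
  assume "\<not> 0 \<le> c"
  hence "2 powr c < (1::real)" by (simp add: powr_less_one)
  moreover have "rpow 1 c * d \<le> rpow 2 c * d" by (rule mono_onD[OF assms(1)]) auto
  hence "1 \<le> 2 powr c" using assms(2) by (simp add: rpow_pos)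
  ultimately show False by simp
qed

text \<open>Derivatives are available on the symmetric interval, the equations only for
  \<open>r > 0\<close> because of \<open>m / r\<close>. The absolute value in the last equation
  comes from the norm of the gradient.\<close>

locale radial_ode =
  fixes U w w' V Z Z' h :: "real \<Rightarrow> real" and R a b p :: real and m :: nat
  assumes R_pos: "0 < R" and exps: "0 \<le> a" "0 \<le> b" "0 \<le> p"
    and h_cont: "continuous_on {0..} h" and h_mono: "mono_on {0..} h"
    and h_pos: "\<And>t. t > 0 \<Longrightarrow> h t > 0" and h_nonneg: "\<And>t. t \<ge> 0 \<Longrightarrow> h t \<ge> 0"
    and U_deriv: "\<And>r. \<bar>r\<bar> < R \<Longrightarrow> (U has_real_derivative w r) (at r)"
    and w_deriv: "\<And>r. \<bar>r\<bar> < R \<Longrightarrow> (w has_real_derivative w' r) (at r)"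
    and V_deriv: "\<And>r. \<bar>r\<bar> < R \<Longrightarrow> (V has_real_derivative Z r) (at r)"
    and Z_deriv: "\<And>r. \<bar>r\<bar> < R \<Longrightarrow> (Z has_real_derivative Z' r) (at r)"
    and init: "w 0 = 0" "Z 0 = 0"
    and U_pos: "\<And>r. 0 \<le> r \<Longrightarrow> r < R \<Longrightarrow> 0 < U r"
    and V_pos: "\<And>r. 0 \<le> r \<Longrightarrow> r < R \<Longrightarrow> 0 < V r"
    and w'_eq: "\<And>r. 0 < r \<Longrightarrow> r < R \<Longrightarrow> w' r = r powr a * V r powr p - real m / r * w r"
    and Z'_eq: "\<And>r. 0 < r \<Longrightarrow> r < R \<Longrightarrow> Z' r = r powr b * h \<bar>w r\<bar> - real m / r * Z r"
begin

lemma w_nonneg: "0 \<le> r \<Longrightarrow> r < R \<Longrightarrow> 0 \<le> w r"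
  by (rule flux_nonneg[OF w_deriv init(1) w'_eq]) auto

lemma Z_nonneg: "0 \<le> r \<Longrightarrow> r < R \<Longrightarrow> 0 \<le> Z r"
  by (rule flux_nonneg[OF Z_deriv init(2) Z'_eq]) (auto simp: h_nonneg)

lemma U_mono: "0 \<le> s \<Longrightarrow> s \<le> r \<Longrightarrow> r < R \<Longrightarrow> U s \<le> U r"
  by (rule nonneg_deriv_imp_le[OF _ U_deriv w_nonneg]) auto

lemma V_mono: "0 \<le> s \<Longrightarrow> s \<le> r \<Longrightarrow> r < R \<Longrightarrow> V s \<le> V r"
  by (rule nonneg_deriv_imp_le[OF _ V_deriv Z_nonneg]) auto

lemma source_w_mono:
  assumes "0 < s" "s \<le> r" "r < R"
  shows "s powr a * V s powr p \<le> r powr a * V r powr p"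
  using assms V_mono[of s r] V_pos[of s] exps
  by (intro mult_mono powr_mono2) auto

text \<open>\<open>V\<close> is nondecreasing and the exponents are nonnegative, so the source is
  monotone and the drift term costs the factor \<open>Suc m\<close>.\<close>

lemma w'_bounds:
  assumes "0 < r" "r < R"
  shows "r powr a * V r powr p / real (Suc m) \<le> w' r" "w' r \<le> r powr a * V r powr p"
  by (rule flux_bounds[OF w_deriv init(1) w'_eq _ source_w_mono assms]; simp)+

lemma w'_pos:
  assumes "0 < r" "r < R"
  shows "0 < w' r"
proof -
  have "0 < r powr a * V r powr p / real (Suc m)" using assms V_pos[of r] by simp
  thus ?thesis using w'_bounds(1)[OF assms] by simp
qed

lemma w_cont: "r < R \<Longrightarrow> continuous_on {0..r} w"
  by (intro DERIV_continuous_on[where D=w'] DERIV_subset[OF w_deriv]) auto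

lemma Z_cont: "r < R \<Longrightarrow> continuous_on {0..r} Z"
  by (intro DERIV_continuous_on[where D=Z'] DERIV_subset[OF Z_deriv]) auto

text \<open>Strict positivity away from the origin is needed because \<open>h\<close> is known to be
  positive only at positive arguments.\<close>

lemma w_pos:
  assumes "0 < r" "r < R"
  shows "0 < w r"
proof -
  have "w 0 < w r"
  proof (rule DERIV_pos_imp_increasing_open[OF assms(1) _ w_cont[OF assms(2)]])
    fix x assume "0 < x" "x < r"
    thus "\<exists>y. (w has_real_derivative y) (at x) \<and> 0 < y"
      using w_deriv[of x] w'_pos[of x] assms by auto
  qed
  thus ?thesis by (simp add: init)
qed

lemma w_mono: "0 \<le> s \<Longrightarrow> s \<le> r \<Longrightarrow> r < R \<Longrightarrow> w s \<le> w r"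
proof (cases "s = 0")
  case False
  assume "0 \<le> s" "s \<le> r" "r < R"
  thus ?thesis using False by (intro nonneg_deriv_imp_le[OF _ w_deriv less_imp_le[OF w'_pos]]) auto
qed (use w_nonneg init in auto)

lemma source_Z_mono:
  assumes "0 < s" "s \<le> r" "r < R"
  shows "s powr b * h \<bar>w s\<bar> \<le> r powr b * h \<bar>w r\<bar>"
proof -
  have "h \<bar>w s\<bar> \<le> h \<bar>w r\<bar>"
    using assms w_mono[of s r] w_nonneg[of s] by (intro mono_onD[OF h_mono]) auto
  thus ?thesis using assms exps h_nonneg by (intro mult_mono powr_mono2) auto
qed

lemma Z'_bounds:
  assumes "0 < r" "r < R"
  shows "r powr b * h (w r) / real (Suc m) \<le> Z' r" "Z' r \<le> r powr b * h (w r)"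
proof -
  have *: "0 \<le> r powr b * h \<bar>w r\<bar>" for r by (simp add: h_nonneg)
  have "r powr b * h \<bar>w r\<bar> / real (Suc m) \<le> Z' r" "Z' r \<le> r powr b * h \<bar>w r\<bar>"
    by (rule flux_bounds[OF Z_deriv init(2) Z'_eq * source_Z_mono assms]; simp)+
  thus "r powr b * h (w r) / real (Suc m) \<le> Z' r" "Z' r \<le> r powr b * h (w r)"
    using w_nonneg[of r] assms by simp_all
qed

lemma Z_pos:
  assumes "0 < r" "r < R"
  shows "0 < Z r"
proof -
  have "Z 0 < Z r"
  proof (rule DERIV_pos_imp_increasing_open[OF assms(1) _ Z_cont[OF assms(2)]])
    fix x assume x: "0 < x" "x < r"
    hence "0 < x powr b * h (w x) / real (Suc m)" using h_pos w_pos[of x] assms by simp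
    hence "0 < Z' x" using Z'_bounds(1)[of x] x assms by simp
    thus "\<exists>y. (Z has_real_derivative y) (at x) \<and> 0 < y"
      using Z_deriv[of x] x assms by auto
  qed
  thus ?thesis by (simp add: init)
qed

text \<open>On \<open>[R / 2, R)\<close> the weights lie between their values at the ends, as
  \<open>a\<close> and \<open>b\<close> are nonnegative; the divisor \<open>Suc m\<close> is the
  loss from the drift term.\<close>

sublocale bs: boundary_system w V Z w' Z' h "R / 2" R p
  "(R / 2) powr a / real (Suc m)" "R powr a" "(R / 2) powr b / real (Suc m)" "R powr b"
proof
  fix r assume r: "R / 2 \<le> r" "r < R"
  hence r': "0 < r" "r < R" "\<bar>r\<bar> < R" using R_pos by auto
  have pw: "(R / 2) powr a \<le> r powr a" "r powr a \<le> R powr a"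
    "(R / 2) powr b \<le> r powr b" "r powr b \<le> R powr b"
    using r r' R_pos exps by (auto intro!: powr_mono2)
  show "(w has_real_derivative w' r) (at r)" "(V has_real_derivative Z r) (at r)"
    "(Z has_real_derivative Z' r) (at r)" "0 < w r" "0 < V r" "0 < Z r"
    using r' w_deriv V_deriv Z_deriv w_pos V_pos Z_pos by auto
  have hw: "0 \<le> h (w r)" using h_nonneg w_nonneg r' by simp
  show "(R / 2) powr a / real (Suc m) * V r powr p \<le> w' r"
  proof (rule order_trans[OF _ w'_bounds(1)[OF r'(1,2)]])
    show "(R / 2) powr a / real (Suc m) * V r powr p \<le> r powr a * V r powr p / real (Suc m)"
      using mult_right_mono[OF pw(1), of "V r powr p"] by (simp add: divide_right_mono)
  qed
  show "w' r \<le> R powr a * V r powr p"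
    by (rule order_trans[OF w'_bounds(2)[OF r'(1,2)] mult_right_mono[OF pw(2)]]) simp
  show "(R / 2) powr b / real (Suc m) * h (w r) \<le> Z' r"
  proof (rule order_trans[OF _ Z'_bounds(1)[OF r'(1,2)]])
    show "(R / 2) powr b / real (Suc m) * h (w r) \<le> r powr b * h (w r) / real (Suc m)"
      using mult_right_mono[OF pw(3) hw] by (simp add: divide_right_mono)
  qed
  show "Z' r \<le> R powr b * h (w r)"
    by (rule order_trans[OF Z'_bounds(2)[OF r'(1,2)] mult_right_mono[OF pw(4) hw]])
qed (use R_pos exps h_cont h_mono h_pos in auto)

text \<open>A bound for \<open>w\<close> on \<open>[R / 2, R)\<close> would bound \<open>V\<close>
  there, and monotonicity of \<open>V\<close> would carry that bound down to the origin.\<close>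

lemma w_unbounded:
  assumes "\<not> (\<exists>B. \<forall>r. 0 \<le> r \<and> r < R \<longrightarrow> V r \<le> B)"
  shows "\<exists>r. R / 2 \<le> r \<and> r < R \<and> s \<le> w r"
proof (rule ccontr)
  assume "\<not> ?thesis"
  hence "w r \<le> s" if "R / 2 \<le> r" "r < R" for r using that by force
  then obtain B where B: "\<And>r. R / 2 \<le> r \<Longrightarrow> r < R \<Longrightarrow> V r \<le> B"
    using bs.V_bounded_if_w_bounded by blast
  have "V r \<le> B" if "0 \<le> r" "r < R" for r
    using B[of "max r (R / 2)"] V_mono[of r "max r (R / 2)"] that R_pos by auto
  thus False using assms by blast
qed

lemma U_bounded:
  assumes "\<exists>B. \<forall>r. 0 \<le> r \<and> r < R \<longrightarrow> V r \<le> B"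
  shows "\<exists>B. \<forall>r. 0 \<le> r \<and> r < R \<longrightarrow> U r \<le> B"
proof -
  obtain B where B: "\<And>r. R / 2 \<le> r \<Longrightarrow> r < R \<Longrightarrow> w r \<le> B"
    using bs.w_bounded_if_V_bounded assms R_pos by (metis half_gt_zero order_less_imp_le order_trans)
  have "U r \<le> U (R / 2) + \<bar>B\<bar> * (R - R / 2)" if r: "R / 2 \<le> r" "r < R" for r
    by (rule bs.le_of_deriv_le[OF U_deriv B r]) (use R_pos in auto)
  hence "U r \<le> U (R / 2) + \<bar>B\<bar> * (R - R / 2)" if "0 \<le> r" "r < R" for r
    using that U_mono[of r "max r (R / 2)"] R_pos by (smt (verit) field_sum_of_halves)
  thus ?thesis by blast
qed

lemma KO_0_finite:
  assumes "\<not> (\<exists>B. \<forall>r. 0 \<le> r \<and> r < R \<longrightarrow> V r \<le> B)"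
  shows "KO_integral 0 h p < \<infinity>"
proof (rule bs.KO_integral_finite[of "\<lambda>r. r" 0 R, OF _ _ w_unbounded[OF assms]])
  show "((\<lambda>r. r) has_real_derivative w r ^ 0) (at r)" for r by simp
qed simp

lemma KO_1_finite:
  assumes "\<not> (\<exists>B. \<forall>r. 0 \<le> r \<and> r < R \<longrightarrow> V r \<le> B)"
    and "\<exists>B. \<forall>r. 0 \<le> r \<and> r < R \<longrightarrow> U r \<le> B"
  shows "KO_integral 1 h p < \<infinity>"
proof -
  obtain B where B: "\<And>r. 0 \<le> r \<Longrightarrow> r < R \<Longrightarrow> U r \<le> B" using assms(2) by blast
  show ?thesis
    by (rule bs.KO_integral_finite[of U 1 B, OF _ _ w_unbounded[OF assms(1)]])
       (use U_deriv B R_pos in auto)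
qed

text \<open>If \<open>U\<close> is unbounded then so is \<open>V\<close>, and hence
  \<open>w\<close>; the comparison applies with \<open>Y = U\<close>, whose derivative is the first
  power of \<open>w\<close>.\<close>

lemma KO_1_infinite:
  assumes "\<not> (\<exists>B. \<forall>r. 0 \<le> r \<and> r < R \<longrightarrow> U r \<le> B)"
  shows "KO_integral 1 h p = \<infinity>"
proof (rule bs.KO_integral_infinite[of U])
  show "\<exists>r. R / 2 \<le> r \<and> r < R \<and> s \<le> w r" for s using w_unbounded U_bounded assms by blast
  show "\<exists>r. R / 2 \<le> r \<and> r < R \<and> s \<le> U r" for s
  proof -
    obtain r where r: "0 \<le> r" "r < R" "s < U r" using assms by (meson not_le)
    show ?thesis
      using r U_mono[of r "max r (R / 2)"] R_pos by (intro exI[of _ "max r (R / 2)"]) auto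
  qed
  show "(U has_real_derivative w r ^ 1) (at r)" if "R / 2 \<le> r" "r < R" for r
    using U_deriv[of r] that R_pos by simp
qed

end

section \<open>Truncated nonlinearities and continuation past \<open>R\<close>\<close>

lemma lipschitz_clip:
  fixes F :: "real \<Rightarrow> real"
  assumes "L-lipschitz_on {lo..hi} F" "lo \<le> hi"
  shows "L-lipschitz_on UNIV (\<lambda>x. F (max lo (min hi x)))"
proof (rule lipschitz_onI)
  fix x y :: real
  have "dist (F (max lo (min hi x))) (F (max lo (min hi y)))
      \<le> L * dist (max lo (min hi x)) (max lo (min hi y))"
    using assms(2) by (intro lipschitz_onD[OF assms(1)]) auto
  also have "\<dots> \<le> L * dist x y"
    using lipschitz_on_nonneg[OF assms(1)]
    by (intro mult_left_mono) (auto simp: dist_real_def max_def min_def)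
  finally show "dist (F (max lo (min hi x))) (F (max lo (min hi y))) \<le> L * dist x y" .
qed (use lipschitz_on_nonneg[OF assms(1)] in auto)

lemma C1_on_lipschitz:
  fixes h :: "real \<Rightarrow> real"
  assumes "C1_on {0..} h"
  obtains L where "L-lipschitz_on {0..M} h"
proof -
  obtain h' where h': "\<And>x. x \<in> {0..} \<Longrightarrow> (h has_derivative blinfun_apply (h' x)) (at x within {0..})"
    "continuous_on {0..} h'"
    using assms unfolding C1_on_def by blast
  have "compact (h' ` {0..M})"
    by (intro compact_continuous_image continuous_on_subset[OF h'(2)]) auto
  from compact_imp_bounded[OF this]
  obtain B where B: "\<And>v. v \<in> h' ` {0..M} \<Longrightarrow> norm v \<le> B" unfolding bounded_iff by blast
  have "\<bar>B\<bar>-lipschitz_on {0..M} h"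
  proof (rule bounded_derivative_imp_lipschitz)
    fix x assume x: "x \<in> {0..M}"
    show "(h has_derivative blinfun_apply (h' x)) (at x within {0..M})"
      using h'(1)[of x] x by (auto intro: has_derivative_subset)
    show "onorm (blinfun_apply (h' x)) \<le> \<bar>B\<bar>"
      using B[of "h' x"] x by (auto simp: norm_blinfun.rep_eq)
  qed auto
  thus thesis by (rule that)
qed

text \<open>The interval stays away from \<open>0\<close> because for exponents between
  \<open>0\<close> and \<open>1\<close> the power is not Lipschitz there.\<close>

lemma powr_lipschitz:
  fixes lo hi p :: real
  assumes "0 < lo"
  obtains L where "L-lipschitz_on {lo..hi} (\<lambda>x. x powr p)"
proof -
  have "compact ((\<lambda>x. p * x powr (p - 1)) ` {lo..hi})"
    using assms by (intro compact_continuous_image continuous_intros) auto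
  from compact_imp_bounded[OF this]
  obtain B where B: "\<And>v. v \<in> (\<lambda>x. p * x powr (p - 1)) ` {lo..hi} \<Longrightarrow> \<bar>v\<bar> \<le> B"
    unfolding bounded_iff real_norm_def by blast
  have "\<bar>B\<bar>-lipschitz_on {lo..hi} (\<lambda>x. x powr p)"
  proof (rule lipschitz_onI)
    fix x y assume xy: "x \<in> {lo..hi}" "y \<in> {lo..hi}"
    have "norm (x powr p - y powr p) \<le> \<bar>B\<bar> * norm (x - y)"
    proof (rule field_differentiable_bound[OF _ _ _ xy])
      fix z assume z: "z \<in> {lo..hi}"
      show "((\<lambda>x. x powr p) has_real_derivative p * z powr (p - 1)) (at z within {lo..hi})"
        using z assms by (intro DERIV_subset[OF has_real_derivative_powr]) auto
      show "norm (p * z powr (p - 1)) \<le> \<bar>B\<bar>" using B[OF imageI[OF z]] by simp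
    qed auto
    thus "dist (x powr p) (y powr p) \<le> \<bar>B\<bar> * dist x y" by (simp add: dist_real_def)
  qed auto
  thus thesis by (rule that)
qed

lemma continuous_on_right_nbhd:
  fixes f :: "real \<Rightarrow> real"
  assumes f: "continuous_on {r0..R+d} f" and "r0 < R" "0 < d" and lo: "lo < f R" and hi: "f R < hi"
  obtains \<delta> where "0 < \<delta>" "\<delta> \<le> d" "\<And>t. R \<le> t \<Longrightarrow> t < R + \<delta> \<Longrightarrow> lo < f t \<and> f t < hi"
proof -
  define e where "e = min (f R - lo) (hi - f R)"
  have e: "e > 0" using lo hi by (simp add: e_def)
  then obtain \<delta> where \<delta>: "\<delta> > 0" "\<And>t. t \<in> {r0..R+d} \<Longrightarrow> dist t R < \<delta> \<Longrightarrow> dist (f t) (f R) < e"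
    using f assms(2,3) unfolding continuous_on_iff by (metis atLeastAtMost_iff less_eq_real_def add_increasing2 order_refl)
  have "lo < f t \<and> f t < hi" if "R \<le> t" "t < R + min \<delta> d" for t
  proof -
    have "\<bar>f t - f R\<bar> < e" using \<delta>(2)[of t] that assms(2) by (auto simp: dist_real_def)
    moreover have "e \<le> f R - lo" "e \<le> hi - f R" by (auto simp: e_def)
    ultimately show ?thesis by linarith
  qed
  thus thesis using that[of "min \<delta> d"] \<delta>(1) assms(3) by auto
qed

text \<open>Bounds pass to the endpoint only in non-strict form, so the box in which the continued
  solution is kept must leave a margin around the limit value.\<close>

lemma limit_value_bounds:
  fixes f :: "real \<Rightarrow> real"
  assumes f: "continuous_on {r0..R+d} f" and r: "r0 < R" "0 < d"
    and le: "\<And>t. r0 \<le> t \<Longrightarrow> t < R \<Longrightarrow> lo \<le> f t \<and> f t \<le> hi"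
  shows "lo \<le> f R" "f R \<le> hi"
proof -
  have c: "continuous_on (closure {r0..<R}) f"
    by (rule continuous_on_subset[OF f]) (use r in auto)
  have R: "R \<in> closure {r0..<R}" using r by simp
  show "lo \<le> f R" by (rule continuous_ge_on_closure[OF c R]) (use le in auto)
  show "f R \<le> hi" by (rule continuous_le_on_closure[OF c R]) (use le in auto)
qed

text \<open>A bound on \<open>V\<close> bounds all four components on \<open>[R / 2, R)\<close>. The
  truncated system is continued past \<open>R\<close>, and by continuity the continuation stays for
  a short while where the truncation changes nothing, hence solves the original equations.\<close>

lemma (in radial_ode) continuation:
  assumes C1: "C1_on {0..} h" and V_bdd: "\<exists>B. \<forall>r. 0 \<le> r \<and> r < R \<longrightarrow> V r \<le> B"
  obtains S U1 w1 V1 Z1 where "R < S"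
    "\<And>t. R / 2 \<le> t \<Longrightarrow> t < R \<Longrightarrow> U1 t = U t \<and> V1 t = V t"
    "\<And>t. R / 2 < t \<Longrightarrow> t < S \<Longrightarrow> (U1 has_real_derivative w1 t) (at t)"
    "\<And>t. R / 2 < t \<Longrightarrow> t < S \<Longrightarrow>
       (w1 has_real_derivative t powr a * V1 t powr p - real m / t * w1 t) (at t)"
    "\<And>t. R / 2 < t \<Longrightarrow> t < S \<Longrightarrow> (V1 has_real_derivative Z1 t) (at t)"
    "\<And>t. R / 2 < t \<Longrightarrow> t < S \<Longrightarrow>
       (Z1 has_real_derivative t powr b * h (w1 t) - real m / t * Z1 t) (at t)"
    "\<And>t. R / 2 < t \<Longrightarrow> t < S \<Longrightarrow> 0 < U1 t \<and> 0 \<le> w1 t \<and> 0 < V1 t"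
proof -
  obtain BV where BV: "\<And>r. 0 \<le> r \<Longrightarrow> r < R \<Longrightarrow> V r \<le> BV" using V_bdd by blast
  obtain BU where BU: "\<And>r. 0 \<le> r \<Longrightarrow> r < R \<Longrightarrow> U r \<le> BU" using U_bounded[OF V_bdd] by blast
  have "V r \<le> BV" if "R / 2 \<le> r" "r < R" for r using BV that R_pos by simp
  then obtain Bw where Bw: "\<And>r. R / 2 \<le> r \<Longrightarrow> r < R \<Longrightarrow> w r \<le> Bw"
    using bs.w_bounded_if_V_bounded by blast
  obtain BZ where BZ: "\<And>r. R / 2 \<le> r \<Longrightarrow> r < R \<Longrightarrow> Z r \<le> BZ"
    using bs.Z_bounded_if_w_bounded[OF Bw] by blast
  \<comment> \<open>Positive, so that the power is Lipschitz above it, and strictly below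
    \<open>V 0 \<le> V r\<close>, which leaves a margin at \<open>R\<close>. The upper ends
    \<open>BV + 1\<close> and \<open>Bw + 1\<close> serve the same purpose.\<close>
  define lo where "lo = V 0 / 2"
  have lo: "0 < lo" "lo < V 0" using V_pos[of 0] R_pos by (auto simp: lo_def)
  have V_ge: "V 0 \<le> V r" if "0 \<le> r" "r < R" for r using V_mono[of 0 r] that by simp
  have lo_hi: "lo < BV + 1" using lo BV[of 0] R_pos by simp
  have Bw_pos: "0 < Bw" using Bw[of "R/2"] w_pos[of "R/2"] R_pos by simp
  obtain LP where LP: "LP-lipschitz_on {lo..BV+1} (\<lambda>x. x powr p)" using powr_lipschitz[OF lo(1)] .
  obtain LQ where LQ: "LQ-lipschitz_on {0..Bw+1} h" using C1_on_lipschitz[OF C1] .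
  \<comment> \<open>Truncating the nonlinearities outside a box that contains the orbit makes them globally Lipschitz.\<close>
  define P where "P x = max lo (min (BV + 1) x) powr p" for x
  define Q where "Q x = h (max 0 (min (Bw + 1) x))" for x
  have P: "LP-lipschitz_on UNIV P"
    unfolding P_def using lipschitz_clip[OF LP] lo_hi by simp
  have Q: "LQ-lipschitz_on UNIV Q"
    unfolding Q_def using lipschitz_clip[OF LQ] Bw_pos by simp
  have P_eq: "P x = x powr p" if "lo < x" "x < BV + 1" for x using that by (simp add: P_def)
  have Q_eq: "Q x = h x" if "0 \<le> x" "x < Bw + 1" for x using that by (simp add: Q_def)
  have box: "lo < V t" "V t < BV + 1" "0 \<le> w t" "w t < Bw + 1" if "R / 2 \<le> t" "t < R" for t
    using V_ge[of t] lo BV[of t] Bw[OF that] w_nonneg[of t] that R_pos by auto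
  have coeff: "continuous_on {R/2..R+1} (\<lambda>t. t powr a)" "continuous_on {R/2..R+1} (\<lambda>t. t powr b)"
    "continuous_on {R/2..R+1} (\<lambda>t. real m / t)"
    using R_pos by (auto intro!: continuous_intros)
  have half: "R / 2 < R" "R < R + 1" using R_pos by auto
  have dU: "(U has_real_derivative w t) (at t)" if "R / 2 \<le> t" "t < R" for t
    using U_deriv[of t] that R_pos by simp
  have dV: "(V has_real_derivative Z t) (at t)" if "R / 2 \<le> t" "t < R" for t
    using V_deriv[of t] that R_pos by simp
  have dw: "(w has_real_derivative t powr a * P (V t) - real m / t * w t) (at t)"
    if "R / 2 \<le> t" "t < R" for t
    using w_deriv[of t] w'_eq[of t] P_eq[OF box(1,2)[OF that]] that R_pos by simp
  have dZ: "(Z has_real_derivative t powr b * Q (w t) - real m / t * Z t) (at t)"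
    if "R / 2 \<le> t" "t < R" for t
    using Z_deriv[of t] Z'_eq[of t] Q_eq[OF box(3,4)[OF that]] box(3)[OF that] that R_pos by simp
  have bdd: "\<bar>U t\<bar> \<le> max (max BU Bw) (max BV BZ) \<and> \<bar>w t\<bar> \<le> max (max BU Bw) (max BV BZ)
    \<and> \<bar>V t\<bar> \<le> max (max BU Bw) (max BV BZ) \<and> \<bar>Z t\<bar> \<le> max (max BU Bw) (max BV BZ)"
    if "R / 2 \<le> t" "t < R" for t
    using BU[of t] Bw[OF that] BV[of t] BZ[OF that] U_pos[of t] w_nonneg[of t] V_pos[of t]
      Z_nonneg[of t] that R_pos by auto
  obtain d U1 w1 V1 Z1 where d: "0 < d" "R + d \<le> R + 1"
    and c: "continuous_on {R/2..R+d} U1" "continuous_on {R/2..R+d} w1"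
      "continuous_on {R/2..R+d} V1" "continuous_on {R/2..R+d} Z1"
    and eq: "\<And>t. R/2 \<le> t \<Longrightarrow> t < R \<Longrightarrow> U1 t = U t \<and> w1 t = w t \<and> V1 t = V t \<and> Z1 t = Z t"
    and D: "\<And>t. R/2 < t \<Longrightarrow> t < R + d \<Longrightarrow> (U1 has_real_derivative w1 t) (at t)"
      "\<And>t. R/2 < t \<Longrightarrow> t < R + d \<Longrightarrow> (w1 has_real_derivative t powr a * P (V1 t) - real m / t * w1 t) (at t)"
      "\<And>t. R/2 < t \<Longrightarrow> t < R + d \<Longrightarrow> (V1 has_real_derivative Z1 t) (at t)"
      "\<And>t. R/2 < t \<Longrightarrow> t < R + d \<Longrightarrow> (Z1 has_real_derivative t powr b * Q (w1 t) - real m / t * Z1 t) (at t)"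
    by (rule system_extension[OF half coeff P Q dU dw dV dZ bdd]) (assumption | rule that)+
  have "V 0 \<le> V1 R" "V1 R \<le> BV"
    by (rule limit_value_bounds[OF c(3) half(1) d(1), of "V 0" BV]; use eq V_ge BV R_pos in simp)+
  then obtain d1 where d1: "0 < d1" "d1 \<le> d" "\<And>t. R \<le> t \<Longrightarrow> t < R + d1 \<Longrightarrow> lo < V1 t \<and> V1 t < BV + 1"
    using continuous_on_right_nbhd[OF c(3) half(1) d(1), of lo "BV + 1"] lo by auto
  \<comment> \<open>The lower bound \<open>w (R / 2) > 0\<close> makes \<open>w1 R\<close> strictly
    positive; \<open>w1\<close> therefore remains nonnegative beyond \<open>R\<close>, where
    \<open>h\<close> must be evaluated at the norm of the gradient.\<close>
  have "w (R / 2) \<le> w1 R" "w1 R \<le> Bw"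
    by (rule limit_value_bounds[OF c(2) half(1) d(1), of "w (R / 2)" Bw]; use eq w_mono Bw R_pos in simp)+
  then obtain d2 where d2: "0 < d2" "d2 \<le> d" "\<And>t. R \<le> t \<Longrightarrow> t < R + d2 \<Longrightarrow> 0 < w1 t \<and> w1 t < Bw + 1"
    using continuous_on_right_nbhd[OF c(2) half(1) d(1), of 0 "Bw + 1"] w_pos[of "R / 2"] R_pos by auto
  have "U 0 \<le> U1 R" "U1 R \<le> BU"
    by (rule limit_value_bounds[OF c(1) half(1) d(1), of "U 0" BU]; use eq U_mono BU R_pos in simp)+
  then obtain d3 where d3: "0 < d3" "d3 \<le> d" "\<And>t. R \<le> t \<Longrightarrow> t < R + d3 \<Longrightarrow> 0 < U1 t \<and> U1 t < BU + 1"
    using continuous_on_right_nbhd[OF c(1) half(1) d(1), of 0 "BU + 1"] U_pos[of 0] R_pos by auto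
  define S where "S = R + min d1 (min d2 d3)"
  have S: "R < S" "S \<le> R + d" using d1 d2 d3 by (auto simp: S_def)
  have all: "lo < V1 t \<and> V1 t < BV + 1 \<and> 0 \<le> w1 t \<and> w1 t < Bw + 1 \<and> 0 < U1 t"
    if "R / 2 < t" "t < S" for t
  proof (cases "t < R")
    case True
    thus ?thesis using eq[of t] box[of t] U_pos[of t] that R_pos by auto
  next
    case False
    hence "t < R + d1" "t < R + d2" "t < R + d3" using that by (auto simp: S_def)
    thus ?thesis using d1(3)[of t] d2(3)[of t] d3(3)[of t] False by (simp add: less_imp_le)
  qed
  show thesis
  proof (rule that[OF S(1), of U1 V1 w1 Z1])
    fix t assume t: "R / 2 < t" "t < S"
    hence t': "t < R + d" using S(2) by simp
    show "(U1 has_real_derivative w1 t) (at t)" "(V1 has_real_derivative Z1 t) (at t)"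
      using D(1,3)[OF t(1) t'] .
    show "(w1 has_real_derivative t powr a * V1 t powr p - real m / t * w1 t) (at t)"
      using D(2)[OF t(1) t'] P_eq[of "V1 t"] all[OF t] by simp
    show "(Z1 has_real_derivative t powr b * h (w1 t) - real m / t * Z1 t) (at t)"
      using D(4)[OF t(1) t'] Q_eq[of "w1 t"] all[OF t] by simp
    show "0 < U1 t \<and> 0 \<le> w1 t \<and> 0 < V1 t" using all[OF t] lo by auto
  qed (use eq in auto)
qed

section \<open>Boundary behaviour and continuation of radial solutions\<close>

context
  fixes u :: "'a::euclidean_space \<Rightarrow> real" and U :: "real \<Rightarrow> real" and R :: real
  assumes R: "0 < R" and u_eq: "\<And>x. x \<in> ball 0 R \<Longrightarrow> u x = U (norm x)"
begin

lemma profile_eq: "e \<in> Basis \<Longrightarrow> 0 \<le> r \<Longrightarrow> r < R \<Longrightarrow> u (r *\<^sub>R e) = U r"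
  using u_eq[of "r *\<^sub>R e"] by simp

lemma bounded_on_ball_iff_profile:
  assumes pos: "\<And>r. 0 \<le> r \<Longrightarrow> r < R \<Longrightarrow> 0 < U r"
  shows "bounded_on_ball R u \<longleftrightarrow> (\<exists>B. \<forall>r. 0 \<le> r \<and> r < R \<longrightarrow> U r \<le> B)"
proof
  assume "bounded_on_ball R u"
  then obtain B where B: "\<And>x. x \<in> ball 0 R \<Longrightarrow> \<bar>u x\<bar> \<le> B"
    unfolding bounded_on_ball_def bounded_iff real_norm_def by blast
  obtain e :: 'a where e: "e \<in> Basis" by (rule that[OF SOME_Basis])
  have "U r \<le> B" if "0 \<le> r" "r < R" for r
    using B[of "r *\<^sub>R e"] profile_eq[OF e that] e that by simp
  thus "\<exists>B. \<forall>r. 0 \<le> r \<and> r < R \<longrightarrow> U r \<le> B" by blast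
next
  assume "\<exists>B. \<forall>r. 0 \<le> r \<and> r < R \<longrightarrow> U r \<le> B"
  then obtain B where B: "\<And>r. 0 \<le> r \<Longrightarrow> r < R \<Longrightarrow> U r \<le> B" by blast
  have "\<bar>u x\<bar> \<le> B" if "x \<in> ball 0 R" for x
    using u_eq[OF that] B[of "norm x"] pos[of "norm x"] that by simp
  thus "bounded_on_ball R u" unfolding bounded_on_ball_def bounded_iff real_norm_def by blast
qed

text \<open>For a nondecreasing profile, being unbounded and tending to infinity are the same; the
  pulled-back filter sees only the norm, so uniformity in the direction is automatic.\<close>

lemma blows_up_iff_profile:
  assumes mono: "\<And>s r. 0 \<le> s \<Longrightarrow> s \<le> r \<Longrightarrow> r < R \<Longrightarrow> U s \<le> U r"
  shows "blows_up R u \<longleftrightarrow> \<not> (\<exists>B. \<forall>r. 0 \<le> r \<and> r < R \<longrightarrow> U r \<le> B)"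
proof
  assume "blows_up R u"
  hence ev: "\<forall>\<^sub>F x in filtercomap norm (at_left R). Z \<le> u x" for Z
    unfolding blows_up_def filterlim_at_top by blast
  show "\<not> (\<exists>B. \<forall>r. 0 \<le> r \<and> r < R \<longrightarrow> U r \<le> B)"
  proof
    assume "\<exists>B. \<forall>r. 0 \<le> r \<and> r < R \<longrightarrow> U r \<le> B"
    then obtain B where B: "\<And>r. 0 \<le> r \<Longrightarrow> r < R \<Longrightarrow> U r \<le> B" by blast
    obtain Q where Q: "eventually Q (at_left R)" "\<And>x. Q (norm x) \<Longrightarrow> B + 1 \<le> u x"
      using ev[of "B + 1"] unfolding eventually_filtercomap by blast
    obtain c where c: "c < R" "\<And>y. c < y \<Longrightarrow> y < R \<Longrightarrow> Q y"
      using Q(1) eventually_at_left[OF R] by blast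
    define r where "r = (max c 0 + R) / 2"
    have r: "0 \<le> r" "c < r" "r < R" using c(1) R by (auto simp: r_def)
    obtain e :: 'a where e: "e \<in> Basis" by (rule that[OF SOME_Basis])
    have "B + 1 \<le> u (r *\<^sub>R e)" using Q(2)[of "r *\<^sub>R e"] c(2)[OF r(2,3)] e r by simp
    thus False using profile_eq[OF e r(1,3)] B[OF r(1,3)] by simp
  qed
next
  assume unb: "\<not> (\<exists>B. \<forall>r. 0 \<le> r \<and> r < R \<longrightarrow> U r \<le> B)"
  show "blows_up R u"
    unfolding blows_up_def filterlim_at_top
  proof
    fix Z
    obtain r where r: "0 \<le> r" "r < R" "Z < U r" using unb by (meson not_le)
    have "eventually (\<lambda>y. r < y \<and> y < R) (at_left R)"
      using eventually_at_left[OF R] r by blast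
    moreover have "Z \<le> u x" if "r < norm x \<and> norm x < R" for x
      using u_eq[of x] mono[of r "norm x"] r that by simp
    ultimately show "\<forall>\<^sub>F x in filtercomap norm (at_left R). Z \<le> u x"
      unfolding eventually_filtercomap by blast
  qed
qed

end

text \<open>The original \<open>u\<close> is kept inside the ball, so that regularity and the
  equations at the origin are inherited and not rederived from a profile.\<close>

definition radial_glue :: "('a::euclidean_space \<Rightarrow> real) \<Rightarrow> (real \<Rightarrow> real) \<Rightarrow> real \<Rightarrow> 'a \<Rightarrow> real" where
  "radial_glue u U R x = (if norm x < R then u x else U (norm x))"

lemma radial_glue_inner: "x \<in> ball 0 R \<Longrightarrow> radial_glue u U R x = u x"
  by (simp add: radial_glue_def)

lemma radial_glue_laplacian_inner: "x \<in> ball 0 R \<Longrightarrow> laplacian (radial_glue u U R) x = laplacian u x"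
  by (rule laplacian_cong[OF open_ball _ radial_glue_inner])

lemma radial_glue_grad_inner: "x \<in> ball 0 R \<Longrightarrow> grad (radial_glue u U R) x = grad u x"
  by (rule grad_cong[OF open_ball _ radial_glue_inner])

lemma radial_glue_radial:
  fixes u :: "'a::euclidean_space \<Rightarrow> real"
  shows "radial_on R u \<Longrightarrow> radial_on S (radial_glue u U R)"
  unfolding radial_on_def
proof (intro ballI impI)
  fix x y :: 'a
  assume rad: "\<forall>x\<in>ball 0 R. \<forall>y\<in>ball 0 R. norm x = norm y \<longrightarrow> u x = u y" and xy: "norm x = norm y"
  show "radial_glue u U R x = radial_glue u U R y"
  proof (cases "norm x < R")
    case True
    hence "u x = u y" using rad[rule_format, of x y] xy by auto
    thus ?thesis using xy by (simp add: radial_glue_def)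
  qed (use xy in \<open>simp add: radial_glue_def\<close>)
qed

context
  fixes u :: "'a::euclidean_space \<Rightarrow> real" and U W W' :: "real \<Rightarrow> real" and R S \<alpha> :: real
  assumes \<alpha>: "0 \<le> \<alpha>" "\<alpha> < R"
    and u_eq: "\<And>x. \<alpha> < norm x \<Longrightarrow> norm x < R \<Longrightarrow> u x = U (norm x)"
    and U: "\<And>r. \<alpha> < r \<Longrightarrow> r < S \<Longrightarrow> (U has_real_derivative W r) (at r)"
    and W: "\<And>r. \<alpha> < r \<Longrightarrow> r < S \<Longrightarrow> (W has_real_derivative W' r) (at r)"
begin

lemma radial_glue_outer: "x \<in> {x. \<alpha> < norm x \<and> norm x < S} \<Longrightarrow> radial_glue u U R x = U (norm x)"
  by (simp add: radial_glue_def u_eq)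

text \<open>The ball of radius \<open>R\<close> and the annulus from \<open>\<alpha>\<close> to
  \<open>S\<close> are open and cover the larger ball. They overlap because
  \<open>\<alpha> < R\<close>, so no matching of derivatives at radius \<open>R\<close> is
  required.\<close>

lemma radial_glue_C2_on:
  assumes "C2_on (ball 0 R) u" "continuous_on {\<alpha><..<S} W'"
  shows "C2_on (ball 0 S) (radial_glue u U R)"
proof (rule C2_on_localI)
  fix x :: 'a assume x: "x \<in> ball 0 S"
  show "\<exists>T g. open T \<and> x \<in> T \<and> C2_on T g \<and> (\<forall>y\<in>T. radial_glue u U R y = g y)"
  proof (cases "norm x < R")
    case True
    thus ?thesis using assms(1) radial_glue_inner by (intro exI[of _ "ball 0 R"] exI[of _ u]) auto
  next
    case False
    thus ?thesis
      using open_annulus[of \<alpha> S] radial_C2_on[OF \<alpha>(1) U W assms(2)] radial_glue_outer x \<alpha>(2)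
      by (intro exI[of _ "{x. \<alpha> < norm x \<and> norm x < S}"] exI[of _ "\<lambda>x. U (norm x)"]) auto
  qed
qed simp

lemma radial_glue_laplacian_outer:
  assumes "\<alpha> < norm x" "norm x < S"
  shows "laplacian (radial_glue u U R) x = W' (norm x) + real (DIM('a) - 1) / norm x * W (norm x)"
  using laplacian_cong[OF open_annulus _ radial_glue_outer, of x \<alpha> S] radial_laplacian[OF \<alpha>(1) U W assms]
    assms by simp

lemma radial_glue_grad_outer:
  assumes "\<alpha> < norm x" "norm x < S"
  shows "norm (grad (radial_glue u U R) x) = \<bar>W (norm x)\<bar>"
proof -
  have x: "x \<noteq> 0" using assms \<alpha> by auto
  have "grad (radial_glue u U R) x = (W (norm x) / norm x) *\<^sub>R x"
    using grad_cong[OF open_annulus _ radial_glue_outer, of x \<alpha> S] radial_grad[OF x U[OF assms]]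
      assms by simp
  thus ?thesis using x by simp
qed

end

text \<open>The second derivatives of the profiles are given by the equations themselves, so
  continuity of the right-hand sides yields \<open>C2\<close>. Nonnegativity of \<open>W\<close>
  identifies it with the norm of the gradient.\<close>

lemma positive_radial_solution_extend:
  fixes u v :: "'a::euclidean_space \<Rightarrow> real"
  assumes sol: "positive_radial_solution g f R u v" and \<alpha>: "0 \<le> \<alpha>" "\<alpha> < R" "R < S"
    and u_eq: "\<And>x. \<alpha> < norm x \<Longrightarrow> norm x < R \<Longrightarrow> u x = U (norm x)"
    and v_eq: "\<And>x. \<alpha> < norm x \<Longrightarrow> norm x < R \<Longrightarrow> v x = V (norm x)"
    and U: "\<And>r. \<alpha> < r \<Longrightarrow> r < S \<Longrightarrow> (U has_real_derivative W r) (at r)"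
    and W: "\<And>r. \<alpha> < r \<Longrightarrow> r < S \<Longrightarrow> (W has_real_derivative
              g r (V r) - real (DIM('a) - 1) / r * W r) (at r)"
    and V: "\<And>r. \<alpha> < r \<Longrightarrow> r < S \<Longrightarrow> (V has_real_derivative Z r) (at r)"
    and Z: "\<And>r. \<alpha> < r \<Longrightarrow> r < S \<Longrightarrow> (Z has_real_derivative
              f r (W r) - real (DIM('a) - 1) / r * Z r) (at r)"
    and cont: "continuous_on {\<alpha><..<S} (\<lambda>r. g r (V r))" "continuous_on {\<alpha><..<S} (\<lambda>r. f r (W r))"
    and pos: "\<And>r. \<alpha> < r \<Longrightarrow> r < S \<Longrightarrow> 0 < U r \<and> 0 \<le> W r \<and> 0 < V r"
  shows "\<not> non_continuable g f R u v"
proof -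
  let ?u = "radial_glue u U R" and ?v = "radial_glue v V R"
  have WZ: "continuous_on {\<alpha><..<S} W" "continuous_on {\<alpha><..<S} Z"
    by (rule DERIV_continuous_on[OF DERIV_subset[OF W]] DERIV_continuous_on[OF DERIV_subset[OF Z]]; simp)+
  have cont': "continuous_on {\<alpha><..<S} (\<lambda>r. g r (V r) - real (DIM('a) - 1) / r * W r)"
    "continuous_on {\<alpha><..<S} (\<lambda>r. f r (W r) - real (DIM('a) - 1) / r * Z r)"
    using \<alpha> by (intro continuous_intros cont WZ; force)+
  note U_glue = \<alpha>(1,2) u_eq U W
  note V_glue = \<alpha>(1,2) v_eq V Z
  have S: "C2_on (ball 0 R) u" "C2_on (ball 0 R) v" "radial_on R u" "radial_on R v"
    "\<And>x. x \<in> ball 0 R \<Longrightarrow> u x > 0 \<and> v x > 0"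
    "\<And>x. x \<in> ball 0 R \<Longrightarrow> laplacian u x = g (norm x) (v x)"
    "\<And>x. x \<in> ball 0 R \<Longrightarrow> laplacian v x = f (norm x) (norm (grad u x))"
    using sol unfolding positive_radial_solution_def by auto
  have "positive_radial_solution g f S ?u ?v"
    unfolding positive_radial_solution_def
  proof (intro conjI ballI)
    show "C2_on (ball 0 S) ?u" by (rule radial_glue_C2_on[OF U_glue S(1) cont'(1)])
    show "C2_on (ball 0 S) ?v" by (rule radial_glue_C2_on[OF V_glue S(2) cont'(2)])
    show "radial_on S ?u" by (rule radial_glue_radial[OF S(3)])
    show "radial_on S ?v" by (rule radial_glue_radial[OF S(4)])
    fix x :: 'a assume x: "x \<in> ball 0 S"
    \<comment> \<open>The cases overlap deliberately: each is an open region on which one of the two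
      descriptions of the glued functions is valid.\<close>
    consider "norm x < R" | "\<alpha> < norm x" "norm x < S" using x \<alpha> by force
    hence "?u x > 0 \<and> ?v x > 0 \<and> laplacian ?u x = g (norm x) (?v x) \<and>
      laplacian ?v x = f (norm x) (norm (grad ?u x))"
    proof cases
      case 1
      hence "x \<in> ball 0 R" by simp
      thus ?thesis
        using S(5,6,7)[of x]
        by (simp add: radial_glue_laplacian_inner radial_glue_grad_inner radial_glue_inner del: mem_ball)
    next
      case 2
      have "?u x = U (norm x)" by (rule radial_glue_outer[OF U_glue]) (use 2 in simp_all)
      moreover have "?v x = V (norm x)" by (rule radial_glue_outer[OF V_glue]) (use 2 in simp_all)
      ultimately show ?thesis
        using pos[OF 2] radial_glue_laplacian_outer[OF U_glue 2]
          radial_glue_laplacian_outer[OF V_glue 2] radial_glue_grad_outer[OF U_glue 2]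
        by simp
    qed
    thus "?u x > 0" "?v x > 0" "laplacian ?u x = g (norm x) (?v x)"
      "laplacian ?v x = f (norm x) (norm (grad ?u x))" by auto
  qed
  moreover have "\<forall>x\<in>ball 0 R. ?u x = u x \<and> ?v x = v x"
    using radial_glue_inner by blast
  ultimately show ?thesis using \<alpha>(3) unfolding non_continuable_def by blast
qed

theorem theorem2p2:
  fixes R a b p :: real
    and h :: "real \<Rightarrow> real"
    and g f :: "real \<Rightarrow> real \<Rightarrow> real"
    and u v :: "real ^ 'n \<Rightarrow> real"
  assumes "R > 0"
    and "g = (\<lambda>r t. rpow r a * rpow t p)"
    and "f = (\<lambda>r t. rpow r b * h t)"
    and "admissible g" and "admissible f"
    and "C1_on {0..} h" and "mono_on {0..} h" and "\<And>t. t > 0 \<Longrightarrow> h t > 0"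
    and "positive_radial_solution g f R u v"
  shows
    "(KO_integral 0 h p = \<infinity> \<longrightarrow> bounded_on_ball R u \<and> bounded_on_ball R v) \<and>
     (bounded_on_ball R u \<and> blows_up R v \<longrightarrow> KO_integral 1 h p < \<infinity>) \<and>
     (blows_up R u \<and> blows_up R v \<longrightarrow> KO_integral 0 h p < \<infinity> \<and> KO_integral 1 h p = \<infinity>) \<and>
     (non_continuable g f R u v \<longrightarrow>
        (bounded_on_ball R u \<and> bounded_on_ball R v \<longleftrightarrow> KO_integral 0 h p = \<infinity>) \<and>
        (bounded_on_ball R u \<and> blows_up R v \<longleftrightarrow> KO_integral 1 h p < \<infinity>) \<and>
        (blows_up R u \<and> blows_up R v \<longleftrightarrow>
           KO_integral 0 h p < \<infinity> \<and> KO_integral 1 h p = \<infinity>))"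
proof -
  note R = assms(1) and g = assms(2) and f = assms(3) and h_pos = assms(8)
  have exps: "0 \<le> a" "0 \<le> b" "0 \<le> p"
  proof -
    \<comment> \<open>With the other variable set to \<open>1\<close>, each function is a positive
      multiple of a single power, whose exponent can be tested.\<close>
    have "mono_on {0..} (\<lambda>r. g r 1)" "mono_on {0..} (\<lambda>t. g 1 t)" "mono_on {0..} (\<lambda>r. f r 1)"
      using assms(4,5) unfolding admissible_def by auto
    hence "mono_on {0..} (\<lambda>r. rpow r a * 1)" "mono_on {0..} (\<lambda>r. rpow r p * 1)"
      "mono_on {0..} (\<lambda>r. rpow r b * h 1)"
      by (simp_all add: g f rpow_pos)
    thus "0 \<le> a" "0 \<le> b" "0 \<le> p" using mono_on_rpow_imp_nonneg h_pos by (metis zero_less_one)+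
  qed
  have h_nonneg: "h t \<ge> 0" if "t \<ge> 0" for t
  proof -
    have "f 1 t \<ge> 0" using assms(5) that unfolding admissible_def by auto
    thus ?thesis by (simp add: f rpow_pos)
  qed
  have h_cont: "continuous_on {0..} h"
    using assms(6) unfolding C1_on_def
    by (auto simp: continuous_on_eq_continuous_within intro: has_derivative_continuous)
  have sol: "C2_on (ball 0 R) u" "C2_on (ball 0 R) v" "radial_on R u" "radial_on R v"
    "\<And>x. x \<in> ball 0 R \<Longrightarrow> u x > 0 \<and> v x > 0"
    "\<And>x. x \<in> ball 0 R \<Longrightarrow> laplacian u x = g (norm x) (v x)"
    "\<And>x. x \<in> ball 0 R \<Longrightarrow> laplacian v x = f (norm x) (norm (grad u x))"
    using assms(9) unfolding positive_radial_solution_def by auto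
  define m where "m = DIM(real ^ 'n) - 1"
  obtain U w w' where U: "\<And>x. x \<in> ball 0 R \<Longrightarrow> u x = U (norm x)"
    "\<And>r. \<bar>r\<bar> < R \<Longrightarrow> (U has_real_derivative w r) (at r)"
    "\<And>r. \<bar>r\<bar> < R \<Longrightarrow> (w has_real_derivative w' r) (at r)" "w 0 = 0"
    "\<And>x. x \<in> ball 0 R \<Longrightarrow> x \<noteq> 0 \<Longrightarrow>
       laplacian u x = w' (norm x) + real (DIM(real ^ 'n) - 1) / norm x * w (norm x)"
    "\<And>x. x \<in> ball 0 R \<Longrightarrow> x \<noteq> 0 \<Longrightarrow> norm (grad u x) = \<bar>w (norm x)\<bar>"
    by (rule radial_profile[OF R sol(1,3)]) (rule that)
  obtain V Z Z' where V: "\<And>x. x \<in> ball 0 R \<Longrightarrow> v x = V (norm x)"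
    "\<And>r. \<bar>r\<bar> < R \<Longrightarrow> (V has_real_derivative Z r) (at r)"
    "\<And>r. \<bar>r\<bar> < R \<Longrightarrow> (Z has_real_derivative Z' r) (at r)" "Z 0 = 0"
    "\<And>x. x \<in> ball 0 R \<Longrightarrow> x \<noteq> 0 \<Longrightarrow>
       laplacian v x = Z' (norm x) + real (DIM(real ^ 'n) - 1) / norm x * Z (norm x)"
    "\<And>x. x \<in> ball 0 R \<Longrightarrow> x \<noteq> 0 \<Longrightarrow> norm (grad v x) = \<bar>Z (norm x)\<bar>"
    by (rule radial_profile[OF R sol(2,4)]) (rule that)
  obtain e :: "real ^ 'n" where e: "e \<in> Basis" by (rule that[OF SOME_Basis])
  have UV_pos: "0 < U r" "0 < V r" if "0 \<le> r" "r < R" for r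
    using sol(5)[of "r *\<^sub>R e"] profile_eq[of R u U, OF R U(1) e that] profile_eq[of R v V, OF R V(1) e that] e that by auto
  interpret radial_ode U w w' V Z Z' h R a b p m
  proof
    \<comment> \<open>The differential equations for the profiles are the partial differential
      equations evaluated at the point \<open>r *\<^sub>R e\<close>.\<close>
    fix r assume r: "0 < r" "r < R"
    hence x: "r *\<^sub>R e \<in> ball 0 R" "r *\<^sub>R e \<noteq> 0" "norm (r *\<^sub>R e) = r" using e by auto
    show "w' r = r powr a * V r powr p - real m / r * w r"
      using U(5)[OF x(1,2)] sol(6)[OF x(1)] V(1)[OF x(1)] x(3) r UV_pos[of r]
      by (simp add: m_def g rpow_pos)
    show "Z' r = r powr b * h \<bar>w r\<bar> - real m / r * Z r"
      using V(5)[OF x(1,2)] sol(7)[OF x(1)] U(6)[OF x(1,2)] x(3) r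
      by (simp add: m_def f rpow_pos)
  qed (use R exps h_cont assms(7) h_pos h_nonneg U V UV_pos in auto)
  \<comment> \<open>Both profiles are nondecreasing, so each function is either bounded or blows up,
    and two truth values describe the boundary behaviour completely.\<close>
  define bu where "bu \<longleftrightarrow> (\<exists>B. \<forall>r. 0 \<le> r \<and> r < R \<longrightarrow> U r \<le> B)"
  define bv where "bv \<longleftrightarrow> (\<exists>B. \<forall>r. 0 \<le> r \<and> r < R \<longrightarrow> V r \<le> B)"
  have bounded: "bounded_on_ball R u \<longleftrightarrow> bu" "bounded_on_ball R v \<longleftrightarrow> bv"
    unfolding bu_def bv_def
    by (rule bounded_on_ball_iff_profile[of R u U, OF R U(1) UV_pos(1)]
        bounded_on_ball_iff_profile[of R v V, OF R V(1) UV_pos(2)]; assumption)+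
  have blow: "blows_up R u \<longleftrightarrow> \<not> bu" "blows_up R v \<longleftrightarrow> \<not> bv"
    unfolding bu_def bv_def
    by (rule blows_up_iff_profile[of R u U, OF R U(1) U_mono] blows_up_iff_profile[of R v V, OF R V(1) V_mono]; assumption)+
  have 1: "bv \<Longrightarrow> bu" unfolding bu_def bv_def by (rule U_bounded)
  have 2: "\<not> bv \<Longrightarrow> KO_integral 0 h p < \<infinity>" unfolding bv_def by (rule KO_0_finite)
  have 3: "\<not> bv \<Longrightarrow> bu \<Longrightarrow> KO_integral 1 h p < \<infinity>" unfolding bu_def bv_def by (rule KO_1_finite)
  have 4: "\<not> bu \<Longrightarrow> KO_integral 1 h p = \<infinity>" unfolding bu_def by (rule KO_1_infinite)
  \<comment> \<open>The profiles are continued from radius \<open>R / 2\<close> only, which suffices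
    because gluing retains \<open>u\<close> and \<open>v\<close> in the inner ball.\<close>
  have 5: "\<not> non_continuable g f R u v" if bv: "bv"
  proof -
    obtain S U1 w1 V1 Z1 where S: "R < S"
      "\<And>t. R / 2 \<le> t \<Longrightarrow> t < R \<Longrightarrow> U1 t = U t \<and> V1 t = V t"
      "\<And>t. R / 2 < t \<Longrightarrow> t < S \<Longrightarrow> (U1 has_real_derivative w1 t) (at t)"
      "\<And>t. R / 2 < t \<Longrightarrow> t < S \<Longrightarrow>
         (w1 has_real_derivative t powr a * V1 t powr p - real m / t * w1 t) (at t)"
      "\<And>t. R / 2 < t \<Longrightarrow> t < S \<Longrightarrow> (V1 has_real_derivative Z1 t) (at t)"
      "\<And>t. R / 2 < t \<Longrightarrow> t < S \<Longrightarrow>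
         (Z1 has_real_derivative t powr b * h (w1 t) - real m / t * Z1 t) (at t)"
      "\<And>t. R / 2 < t \<Longrightarrow> t < S \<Longrightarrow> 0 < U1 t \<and> 0 \<le> w1 t \<and> 0 < V1 t"
      by (rule continuation[OF assms(6) bv[unfolded bv_def]]) (rule that)
    have pos: "0 < t" "0 < V1 t" "0 \<le> w1 t" if "R / 2 < t" "t < S" for t
      using S(7)[OF that] that R by auto
    have g_eq: "g t (V1 t) = t powr a * V1 t powr p" if "R / 2 < t" "t < S" for t
      using pos[OF that] by (simp add: g rpow_pos)
    have f_eq: "f t (w1 t) = t powr b * h (w1 t)" if "R / 2 < t" "t < S" for t
      using pos[OF that] by (simp add: f rpow_pos)
    have c: "continuous_on {R/2<..<S} V1" "continuous_on {R/2<..<S} w1"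
      by (rule DERIV_continuous_on[OF DERIV_subset[OF S(5)]]
          DERIV_continuous_on[OF DERIV_subset[OF S(4)]]; simp)+
    have "continuous_on {R/2<..<S} (\<lambda>t. t powr a * V1 t powr p)"
      using pos by (intro continuous_intros c) force+
    hence cg: "continuous_on {R/2<..<S} (\<lambda>t. g t (V1 t))"
      using g_eq by (simp cong: continuous_on_cong_simp)
    have "continuous_on {R/2<..<S} (\<lambda>t. t powr b * h (w1 t))"
      using pos by (intro continuous_intros continuous_on_compose2[OF h_cont c(2)]) force+
    hence cf: "continuous_on {R/2<..<S} (\<lambda>t. f t (w1 t))"
      using f_eq by (simp cong: continuous_on_cong_simp)
    show ?thesis
    proof (rule positive_radial_solution_extend[OF assms(9), of "R / 2" S U1 V1 w1 Z1])
      fix x :: "real ^ 'n" assume x: "R / 2 < norm x" "norm x < R"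
      show "u x = U1 (norm x)" "v x = V1 (norm x)"
        using U(1)[of x] V(1)[of x] S(2)[of "norm x"] x by auto
    qed (use S R g_eq f_eq cg cf in \<open>auto simp: m_def\<close>)
  qed
  have finite_iff: "x < \<infinity> \<longleftrightarrow> x \<noteq> \<infinity>" for x :: ennreal by (simp add: less_top)
  show ?thesis
    unfolding bounded blow finite_iff using 1 2[unfolded finite_iff] 3[unfolded finite_iff] 4 5 by blast
qed

end
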